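(* Let $L$ be a finite abelian group, $L^\vee=\mathrm{Hom}(L,\Bbbk^\times)$, and let $\sigma\colon L\xrightarrow{\sim}L^\vee$ be a group isomorphism with $\sigma(\ell)(k)=\sigma(k)(\ell)$ for all $k,\ell\in L$. Let $T_\sigma=\begin{pmatrix}0&\sigma^{-1}\\ \sigma&0\end{pmatrix}\in\mathrm O(L\oplus L^\vee)$, an element of order $2$. Then the map $$f\colon \mathrm O(L\oplus L^\vee)\to\pi_0\mathrm{Aut}_{\mathrm{Fus}}(\mathrm{Vect}[L]),\qquad g\mapsto \mathrm{Sum}_3(C_g),$$ sends $T_\sigma$ to the (value on a point of the) twice-categorified Fourier transform $\mathrm{FT}$, regarded as a $\mathrm{Vect}[L]$-bimodule category by means of $\sigma$.
   Context: $\Bbbk$ is an algebraically closed field of characteristic $0$. $\mathrm O(L\oplus L^\vee)$ is the group of automorphisms of $L\oplus L^\vee$ preserving the quadratic form $\mathrm{ev}(\ell,\phi)=\phi(\ell)$. $\mathrm{Vect}[L]$ is the fusion category of $L$-graded vector spaces with convolution, and $\pi_0\mathrm{Aut}_{\mathrm{Fus}}(\mathrm{Vect}[L])$ is the group of equivalence classes of invertible $\mathrm{Vect}[L]$-bimodule categories. For an abelian group $A$ and a $2$-cocycle $\kappa\in Z^2(A,\Bbbk^\times)$, $\mathrm{alt}\,\kappa$ is the alternating bicharacter $(a_1,a_2)\mapsto\kappa(a_1,a_2)\kappa(a_2,a_1)^{-1}$; $\mathrm{alt}$ induces an isomorphism from $H^2(A,\Bbbk^\times)$ to the group of alternating bicharacters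 of $A$. Correspondences and $\mathrm{Sum}_3$. A correspondence $BL\leftarrow(BC,\kappa)\to BL$, with $C\subset L\oplus L$ a subgroup and $\kappa$ a $2$-cocycle on $C$, is a $1$-morphism in the category $\mathrm{Fam}_3(B^3\Bbbk^\times)$ of $\pi$-finite spaces and correspondences decorated by cochains. $\mathrm{Sum}_3$ sends it to the $\mathrm{Vect}[L]$-bimodule category which corresponds, under $\Bbbk_\ell\otimes M\otimes\Bbbk_k=\Bbbk_{(\ell,-k)}\otimes M$, to the indecomposable $\mathrm{Vect}[L\oplus L]$-module category classified by the subgroup $C$ and the alternating bicharacter $\mathrm{alt}\,\kappa$ on $C$ (its simple objects are the cosets of $C$ in $L\oplus L$). The correspondence $C_g$. For $g\in\mathrm O(L\oplus L^\vee)$ let $\Gamma(g)\subset(L\oplus L^\vee)^2$ be its graph and $p_{1,3}\Gamma(g)\subset L\oplus L$ the projection of the graph to the two copies of $L$. Let $\chi_g$ be the alternating bicharacter on $p_{1,3}\Gamma(g)$ $$\chi_g\big((\ell_1,k_1),(\ell_2,k_2)\big)=\phi(\ell_2)\,\psi(k_2)^{-1},$$ where $\phi\in L^\vee$ is any element such that $g(\ell_1,\phi)$ has $L$-component $k_1$, and $\psi\in L^\vee$ is the $L^\vee$-component of $g(\ell_1,\phi)$. Then $C_g$ is the correspondence $BL\leftarrow(B\,p_{1,3}\Gamma(g),\kappa_g)\to BL$ with $\mathrm{alt}\,\kappa_g=\chi_g$. Fourier transform. $\mathrm{FT}(\mathrm{pt})$ is $\mathrm{Sum}_3$ of the correspondence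 $BL\leftarrow(B(L\oplus L^\vee),\kappa_{\mathrm{ev}})\to BL^\vee$ given by the two projections, with $\kappa_{\mathrm{ev}}$ a $2$-cocycle in the class of the Heisenberg extension, e.g. $\big((\ell,\phi),(k,\psi)\big)\mapsto\psi(\ell)$. Transported to a $\mathrm{Vect}[L]$-bimodule category by means of $\sigma$ (and the inversion map), it is $\mathrm{Sum}_3$ of the correspondence $BL\xleftarrow{p_1}(B(L\oplus L),\kappa_L)\xrightarrow{p_2}BL$ with $$\mathrm{alt}\,\kappa_L\big((\ell_1,k_1),(\ell_2,k_2)\big)=\sigma(k_2)(\ell_1)^{-1}\,\sigma(k_1)(\ell_2).$$
   Formalization: "An element of order 2" is stated as T_σ² = 1 for every L and T_σ ≠ 1 for L non-trivial, because for the trivial group L the element T_σ is the identity and has order 1. *)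

theory Defs
  imports
    "HOL-Algebra.Bij"
    "HOL-Computational_Algebra.Polynomial"
    "Jordan_Normal_Form.Matrix"
begin

section \<open>Linear categories\<close>

text \<open>
  Arrows carry their domain and codomain, so hom-sets of different pairs of objects are disjoint.
  \<open>Comp M g f\<close>, written \<open>g \<cdot> f\<close>, is \<open>g\<close> after \<open>f\<close>.
\<close>

record ('o, 'm, 'k) lincat =
  Ob :: "'o set"
  Arr :: "'m set"
  Dom :: "'m \<Rightarrow> 'o"
  Cod :: "'m \<Rightarrow> 'o"
  Id :: "'o \<Rightarrow> 'm"
  Comp :: "'m \<Rightarrow> 'm \<Rightarrow> 'm" (infixr \<open>\<cdot>\<index>\<close> 70)
  Plus :: "'m \<Rightarrow> 'm \<Rightarrow> 'm"
  Scale :: "'k \<Rightarrow> 'm \<Rightarrow> 'm"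

definition Hom :: "('o, 'm, 'k, 'z) lincat_scheme \<Rightarrow> 'o \<Rightarrow> 'o \<Rightarrow> 'm set" where
  "Hom M X Y = {f \<in> Arr M. Dom M f = X \<and> Cod M f = Y}"

locale linear_category =
  fixes M :: "('o, 'm, 'k::field, 'z) lincat_scheme" (structure)
  assumes dom_cod: "f \<in> Arr M \<Longrightarrow> Dom M f \<in> Ob M \<and> Cod M f \<in> Ob M"
    and id_hom: "X \<in> Ob M \<Longrightarrow> Id M X \<in> Hom M X X"
    and comp_hom: "\<lbrakk>f \<in> Hom M X Y; g \<in> Hom M Y Z\<rbrakk> \<Longrightarrow> g \<cdot> f \<in> Hom M X Z"
    and comp_assoc: "\<lbrakk>f \<in> Hom M X Y; g \<in> Hom M Y Z; h \<in> Hom M Z W\<rbrakk>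
          \<Longrightarrow> (h \<cdot> g) \<cdot> f = h \<cdot> (g \<cdot> f)"
    and id_left: "f \<in> Hom M X Y \<Longrightarrow> Id M Y \<cdot> f = f"
    and id_right: "f \<in> Hom M X Y \<Longrightarrow> f \<cdot> Id M X = f"
    and plus_hom: "\<lbrakk>f \<in> Hom M X Y; g \<in> Hom M X Y\<rbrakk> \<Longrightarrow> Plus M f g \<in> Hom M X Y"
    and plus_assoc: "\<lbrakk>f \<in> Hom M X Y; g \<in> Hom M X Y; h \<in> Hom M X Y\<rbrakk>
          \<Longrightarrow> Plus M (Plus M f g) h = Plus M f (Plus M g h)"
    and plus_comm: "\<lbrakk>f \<in> Hom M X Y; g \<in> Hom M X Y\<rbrakk> \<Longrightarrow> Plus M f g = Plus M g f"
    and zero_ex: "\<lbrakk>X \<in> Ob M; Y \<in> Ob M\<rbrakk> \<Longrightarrow> \<exists>z \<in> Hom M X Y. \<forall>f \<in> Hom M X Y.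
          Plus M f z = f \<and> Plus M f (Scale M (- 1) f) = z"
    and scale_hom: "f \<in> Hom M X Y \<Longrightarrow> Scale M a f \<in> Hom M X Y"
    and scale_plus: "\<lbrakk>f \<in> Hom M X Y; g \<in> Hom M X Y\<rbrakk>
          \<Longrightarrow> Scale M a (Plus M f g) = Plus M (Scale M a f) (Scale M a g)"
    and plus_scale: "f \<in> Hom M X Y \<Longrightarrow> Scale M (a + b) f = Plus M (Scale M a f) (Scale M b f)"
    and scale_scale: "f \<in> Hom M X Y \<Longrightarrow> Scale M a (Scale M b f) = Scale M (a * b) f"
    and scale_one: "f \<in> Hom M X Y \<Longrightarrow> Scale M 1 f = f"
    and comp_plus_left: "\<lbrakk>f \<in> Hom M X Y; g \<in> Hom M Y Z; g' \<in> Hom M Y Z\<rbrakk>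
          \<Longrightarrow> Plus M g g' \<cdot> f = Plus M (g \<cdot> f) (g' \<cdot> f)"
    and comp_plus_right: "\<lbrakk>f \<in> Hom M X Y; f' \<in> Hom M X Y; g \<in> Hom M Y Z\<rbrakk>
          \<Longrightarrow> g \<cdot> Plus M f f' = Plus M (g \<cdot> f) (g \<cdot> f')"
    and comp_scale_left: "\<lbrakk>f \<in> Hom M X Y; g \<in> Hom M Y Z\<rbrakk>
          \<Longrightarrow> Scale M a g \<cdot> f = Scale M a (g \<cdot> f)"
    and comp_scale_right: "\<lbrakk>f \<in> Hom M X Y; g \<in> Hom M Y Z\<rbrakk>
          \<Longrightarrow> g \<cdot> Scale M a f = Scale M a (g \<cdot> f)"

definition iso_arr :: "('o, 'm, 'k, 'z) lincat_scheme \<Rightarrow> 'o \<Rightarrow> 'o \<Rightarrow> 'm \<Rightarrow> bool" where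
  "iso_arr M X Y f \<longleftrightarrow> f \<in> Hom M X Y \<and>
     (\<exists>g \<in> Hom M Y X. g \<cdot>\<^bsub>M\<^esub> f = Id M X \<and> f \<cdot>\<^bsub>M\<^esub> g = Id M Y)"

definition inv_arr :: "('o, 'm, 'k, 'z) lincat_scheme \<Rightarrow> 'm \<Rightarrow> 'm" where
  "inv_arr M f = (THE g. g \<in> Hom M (Cod M f) (Dom M f) \<and>
     g \<cdot>\<^bsub>M\<^esub> f = Id M (Dom M f) \<and> f \<cdot>\<^bsub>M\<^esub> g = Id M (Cod M f))"

definition zero_arr :: "('o, 'm, 'k::field, 'z) lincat_scheme \<Rightarrow> 'm \<Rightarrow> bool" where
  "zero_arr M f \<longleftrightarrow> Scale M 0 f = f"

definition zero_object :: "('o, 'm, 'k::field, 'z) lincat_scheme \<Rightarrow> 'o \<Rightarrow> bool" where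
  "zero_object M Z \<longleftrightarrow> Z \<in> Ob M \<and> zero_arr M (Id M Z)"

definition biproduct :: "('o, 'm, 'k, 'z) lincat_scheme \<Rightarrow> 'o \<Rightarrow> 'o \<Rightarrow> 'o \<Rightarrow> bool" where
  "biproduct M X Y Z \<longleftrightarrow> Z \<in> Ob M \<and>
     (\<exists>i \<in> Hom M X Z. \<exists>j \<in> Hom M Y Z. \<exists>p \<in> Hom M Z X. \<exists>q \<in> Hom M Z Y.
        p \<cdot>\<^bsub>M\<^esub> i = Id M X \<and> q \<cdot>\<^bsub>M\<^esub> j = Id M Y \<and>
        Plus M (i \<cdot>\<^bsub>M\<^esub> p) (j \<cdot>\<^bsub>M\<^esub> q) = Id M Z)"

inductive direct_sum :: "('o, 'm, 'k::field, 'z) lincat_scheme \<Rightarrow> 'o list \<Rightarrow> 'o \<Rightarrow> bool"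
  for M where
  "zero_object M Z \<Longrightarrow> direct_sum M [] Z"
| "\<lbrakk>direct_sum M Xs Y; biproduct M X Y Z\<rbrakk> \<Longrightarrow> direct_sum M (X # Xs) Z"

text \<open>
  Over an algebraically closed field the endomorphism algebra of a simple object is the field
  itself (Schur), so a finite semisimple category is one that is generated under finite direct sums
  by finitely many pairwise orthogonal objects with scalar endomorphisms.
\<close>

definition finite_semisimple :: "('o, 'm, 'k::field, 'z) lincat_scheme \<Rightarrow> bool" where
  "finite_semisimple M \<longleftrightarrow> linear_category M \<and>
     (\<exists>Z. zero_object M Z) \<and> (\<forall>X \<in> Ob M. \<forall>Y \<in> Ob M. \<exists>Z. biproduct M X Y Z) \<and>
     (\<exists>S \<subseteq> Ob M. finite S \<and>
        (\<forall>s \<in> S. \<not> zero_arr M (Id M s) \<and> Hom M s s = range (\<lambda>a. Scale M a (Id M s))) \<and>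
        (\<forall>s \<in> S. \<forall>t \<in> S. s \<noteq> t \<longrightarrow> (\<forall>f \<in> Hom M s t. zero_arr M f)) \<and>
        (\<forall>X \<in> Ob M. \<exists>ss \<in> lists S. direct_sum M ss X))"

definition linear_functor ::
  "('o, 'm, 'k, 'z) lincat_scheme \<Rightarrow> ('p, 'n, 'k, 'y) lincat_scheme
    \<Rightarrow> ('o \<Rightarrow> 'p) \<Rightarrow> ('m \<Rightarrow> 'n) \<Rightarrow> bool" where
  "linear_functor M N FO FA \<longleftrightarrow>
     (\<forall>X \<in> Ob M. FO X \<in> Ob N \<and> FA (Id M X) = Id N (FO X)) \<and>
     (\<forall>f \<in> Arr M. FA f \<in> Hom N (FO (Dom M f)) (FO (Cod M f)) \<and>
        (\<forall>a. FA (Scale M a f) = Scale N a (FA f))) \<and>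
     (\<forall>f \<in> Arr M. \<forall>g \<in> Arr M. Dom M g = Cod M f \<longrightarrow> FA (g \<cdot>\<^bsub>M\<^esub> f) = FA g \<cdot>\<^bsub>N\<^esub> FA f) \<and>
     (\<forall>X Y. \<forall>f \<in> Hom M X Y. \<forall>g \<in> Hom M X Y. FA (Plus M f g) = Plus N (FA f) (FA g))"

definition bilinear_functor ::
  "('o1, 'm1, 'k, 'z1) lincat_scheme \<Rightarrow> ('o2, 'm2, 'k, 'z2) lincat_scheme
    \<Rightarrow> ('p, 'n, 'k, 'y) lincat_scheme \<Rightarrow> ('o1 \<Rightarrow> 'o2 \<Rightarrow> 'p) \<Rightarrow> ('m1 \<Rightarrow> 'm2 \<Rightarrow> 'n) \<Rightarrow> bool" where
  "bilinear_functor M N K BO BA \<longleftrightarrow>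
     (\<forall>X \<in> Ob M. \<forall>Y \<in> Ob N. BO X Y \<in> Ob K \<and> BA (Id M X) (Id N Y) = Id K (BO X Y)) \<and>
     (\<forall>f \<in> Arr M. \<forall>g \<in> Arr N.
        BA f g \<in> Hom K (BO (Dom M f) (Dom N g)) (BO (Cod M f) (Cod N g)) \<and>
        (\<forall>a. BA (Scale M a f) g = Scale K a (BA f g) \<and> BA f (Scale N a g) = Scale K a (BA f g))) \<and>
     (\<forall>f \<in> Arr M. \<forall>f' \<in> Arr M. \<forall>g \<in> Arr N. \<forall>g' \<in> Arr N.
        Dom M f' = Cod M f \<longrightarrow> Dom N g' = Cod N g \<longrightarrow>
        BA (f' \<cdot>\<^bsub>M\<^esub> f) (g' \<cdot>\<^bsub>N\<^esub> g) = BA f' g' \<cdot>\<^bsub>K\<^esub> BA f g) \<and>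
     (\<forall>X Y. \<forall>f \<in> Hom M X Y. \<forall>f' \<in> Hom M X Y. \<forall>g \<in> Arr N.
        BA (Plus M f f') g = Plus K (BA f g) (BA f' g)) \<and>
     (\<forall>X Y. \<forall>f \<in> Arr M. \<forall>g \<in> Hom N X Y. \<forall>g' \<in> Hom N X Y.
        BA f (Plus N g g') = Plus K (BA f g) (BA f g'))"

definition equivalence_functor ::
  "('o, 'm, 'k, 'z) lincat_scheme \<Rightarrow> ('p, 'n, 'k, 'y) lincat_scheme
    \<Rightarrow> ('o \<Rightarrow> 'p) \<Rightarrow> ('m \<Rightarrow> 'n) \<Rightarrow> bool" where
  "equivalence_functor M N FO FA \<longleftrightarrow> linear_functor M N FO FA \<and>
     (\<forall>X \<in> Ob M. \<forall>Y \<in> Ob M. bij_betw FA (Hom M X Y) (Hom N (FO X) (FO Y))) \<and>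
     (\<forall>Z \<in> Ob N. \<exists>X \<in> Ob M. \<exists>f. iso_arr N (FO X) Z f)"


section \<open>Bimodule categories\<close>

record ('o, 'm, 'k) moncat = "('o, 'm, 'k) lincat" +
  TenO :: "'o \<Rightarrow> 'o \<Rightarrow> 'o" (infixr \<open>\<odot>\<index>\<close> 75)
  TenA :: "'m \<Rightarrow> 'm \<Rightarrow> 'm"
  Unit :: "'o"
  Assoc :: "'o \<Rightarrow> 'o \<Rightarrow> 'o \<Rightarrow> 'm"  \<comment> \<open>\<open>(X \<odot> Y) \<odot> Z \<rightarrow> X \<odot> (Y \<odot> Z)\<close>\<close>
  LUnit :: "'o \<Rightarrow> 'm"              \<comment> \<open>\<open>1 \<odot> X \<rightarrow> X\<close>\<close>
  RUnit :: "'o \<Rightarrow> 'm"              \<comment> \<open>\<open>X \<odot> 1 \<rightarrow> X\<close>\<close>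

record ('o, 'm, 'k, 'c, 'cm, 'd, 'dm) bimod = "('o, 'm, 'k) lincat" +
  LActO :: "'c \<Rightarrow> 'o \<Rightarrow> 'o" (infixr \<open>\<triangleright>\<index>\<close> 75)
  LActA :: "'cm \<Rightarrow> 'm \<Rightarrow> 'm"
  RActO :: "'o \<Rightarrow> 'd \<Rightarrow> 'o" (infixl \<open>\<triangleleft>\<index>\<close> 75)
  RActA :: "'m \<Rightarrow> 'dm \<Rightarrow> 'm"
  LAssoc :: "'c \<Rightarrow> 'c \<Rightarrow> 'o \<Rightarrow> 'm"  \<comment> \<open>\<open>(X \<odot> Y) \<triangleright> m \<rightarrow> X \<triangleright> (Y \<triangleright> m)\<close>\<close>
  LUnitor :: "'o \<Rightarrow> 'm"            \<comment> \<open>\<open>1 \<triangleright> m \<rightarrow> m\<close>\<close>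
  RAssoc :: "'o \<Rightarrow> 'd \<Rightarrow> 'd \<Rightarrow> 'm"  \<comment> \<open>\<open>(m \<triangleleft> X) \<triangleleft> Y \<rightarrow> m \<triangleleft> (X \<odot> Y)\<close>\<close>
  RUnitor :: "'o \<Rightarrow> 'm"            \<comment> \<open>\<open>m \<triangleleft> 1 \<rightarrow> m\<close>\<close>
  MAssoc :: "'c \<Rightarrow> 'o \<Rightarrow> 'd \<Rightarrow> 'm"  \<comment> \<open>\<open>(X \<triangleright> m) \<triangleleft> Y \<rightarrow> X \<triangleright> (m \<triangleleft> Y)\<close>\<close>

locale bimodule_category =
  fixes C :: "('c, 'cm, 'k::field) moncat"
    and D :: "('d, 'dm, 'k) moncat"
    and M :: "('o, 'm, 'k, 'c, 'cm, 'd, 'dm) bimod" (structure)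
  assumes semisimple: "finite_semisimple M"
    and left_action: "bilinear_functor C M M (LActO M) (LActA M)"
    and right_action: "bilinear_functor M D M (RActO M) (RActA M)"
    and lassoc_iso: "\<lbrakk>X \<in> Ob C; Y \<in> Ob C; m \<in> Ob M\<rbrakk>
          \<Longrightarrow> iso_arr M ((X \<odot>\<^bsub>C\<^esub> Y) \<triangleright> m) (X \<triangleright> (Y \<triangleright> m)) (LAssoc M X Y m)"
    and lassoc_nat: "\<lbrakk>f \<in> Arr C; g \<in> Arr C; h \<in> Arr M\<rbrakk>
          \<Longrightarrow> LAssoc M (Cod C f) (Cod C g) (Cod M h) \<cdot> LActA M (TenA C f g) h
              = LActA M f (LActA M g h) \<cdot> LAssoc M (Dom C f) (Dom C g) (Dom M h)"
    and lunitor_iso: "m \<in> Ob M \<Longrightarrow> iso_arr M (Unit C \<triangleright> m) m (LUnitor M m)"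
    and lunitor_nat: "h \<in> Arr M
          \<Longrightarrow> LUnitor M (Cod M h) \<cdot> LActA M (Id C (Unit C)) h = h \<cdot> LUnitor M (Dom M h)"
    and rassoc_iso: "\<lbrakk>m \<in> Ob M; P \<in> Ob D; Q \<in> Ob D\<rbrakk>
          \<Longrightarrow> iso_arr M ((m \<triangleleft> P) \<triangleleft> Q) (m \<triangleleft> (P \<odot>\<^bsub>D\<^esub> Q)) (RAssoc M m P Q)"
    and rassoc_nat: "\<lbrakk>h \<in> Arr M; u \<in> Arr D; v \<in> Arr D\<rbrakk>
          \<Longrightarrow> RAssoc M (Cod M h) (Cod D u) (Cod D v) \<cdot> RActA M (RActA M h u) v
              = RActA M h (TenA D u v) \<cdot> RAssoc M (Dom M h) (Dom D u) (Dom D v)"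
    and runitor_iso: "m \<in> Ob M \<Longrightarrow> iso_arr M (m \<triangleleft> Unit D) m (RUnitor M m)"
    and runitor_nat: "h \<in> Arr M
          \<Longrightarrow> RUnitor M (Cod M h) \<cdot> RActA M h (Id D (Unit D)) = h \<cdot> RUnitor M (Dom M h)"
    and massoc_iso: "\<lbrakk>X \<in> Ob C; m \<in> Ob M; P \<in> Ob D\<rbrakk>
          \<Longrightarrow> iso_arr M ((X \<triangleright> m) \<triangleleft> P) (X \<triangleright> (m \<triangleleft> P)) (MAssoc M X m P)"
    and massoc_nat: "\<lbrakk>f \<in> Arr C; h \<in> Arr M; v \<in> Arr D\<rbrakk>
          \<Longrightarrow> MAssoc M (Cod C f) (Cod M h) (Cod D v) \<cdot> RActA M (LActA M f h) v
              = LActA M f (RActA M h v) \<cdot> MAssoc M (Dom C f) (Dom M h) (Dom D v)"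
    and left_pentagon: "\<lbrakk>X \<in> Ob C; Y \<in> Ob C; Z \<in> Ob C; m \<in> Ob M\<rbrakk>
          \<Longrightarrow> LAssoc M X Y (Z \<triangleright> m) \<cdot> LAssoc M (X \<odot>\<^bsub>C\<^esub> Y) Z m
              = LActA M (Id C X) (LAssoc M Y Z m) \<cdot> LAssoc M X (Y \<odot>\<^bsub>C\<^esub> Z) m
                  \<cdot> LActA M (Assoc C X Y Z) (Id M m)"
    and left_triangle: "\<lbrakk>X \<in> Ob C; m \<in> Ob M\<rbrakk>
          \<Longrightarrow> LActA M (Id C X) (LUnitor M m) \<cdot> LAssoc M X (Unit C) m
              = LActA M (RUnit C X) (Id M m)"
    and right_pentagon: "\<lbrakk>m \<in> Ob M; P \<in> Ob D; Q \<in> Ob D; R \<in> Ob D\<rbrakk>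
          \<Longrightarrow> RAssoc M m P (Q \<odot>\<^bsub>D\<^esub> R) \<cdot> RAssoc M (m \<triangleleft> P) Q R
              = RActA M (Id M m) (Assoc D P Q R) \<cdot> RAssoc M m (P \<odot>\<^bsub>D\<^esub> Q) R
                  \<cdot> RActA M (RAssoc M m P Q) (Id D R)"
    and right_triangle: "\<lbrakk>m \<in> Ob M; Q \<in> Ob D\<rbrakk>
          \<Longrightarrow> RActA M (Id M m) (LUnit D Q) \<cdot> RAssoc M m (Unit D) Q
              = RActA M (RUnitor M m) (Id D Q)"
    and mixed_pentagon_left: "\<lbrakk>X \<in> Ob C; Y \<in> Ob C; m \<in> Ob M; P \<in> Ob D\<rbrakk>
          \<Longrightarrow> LAssoc M X Y (m \<triangleleft> P) \<cdot> MAssoc M (X \<odot>\<^bsub>C\<^esub> Y) m P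
              = LActA M (Id C X) (MAssoc M Y m P) \<cdot> MAssoc M X (Y \<triangleright> m) P
                  \<cdot> RActA M (LAssoc M X Y m) (Id D P)"
    and mixed_pentagon_right: "\<lbrakk>X \<in> Ob C; m \<in> Ob M; P \<in> Ob D; Q \<in> Ob D\<rbrakk>
          \<Longrightarrow> MAssoc M X m (P \<odot>\<^bsub>D\<^esub> Q) \<cdot> RAssoc M (X \<triangleright> m) P Q
              = LActA M (Id C X) (RAssoc M m P Q) \<cdot> MAssoc M X (m \<triangleleft> P) Q
                  \<cdot> RActA M (MAssoc M X m P) (Id D Q)"

definition regular_bimodule ::
  "('c, 'cm, 'k) moncat \<Rightarrow> ('c, 'cm, 'k, 'c, 'cm, 'c, 'cm) bimod" where
  "regular_bimodule C =
     \<lparr>Ob = Ob C, Arr = Arr C, Dom = Dom C, Cod = Cod C, Id = Id C, Comp = Comp C,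
      Plus = Plus C, Scale = Scale C,
      LActO = TenO C, LActA = TenA C, RActO = TenO C, RActA = TenA C,
      LAssoc = Assoc C, LUnitor = LUnit C, RAssoc = Assoc C, RUnitor = RUnit C,
      MAssoc = Assoc C\<rparr>"

text \<open>
  A functor of bimodule categories is a linear functor \<open>F\<close> with natural isomorphisms
  \<open>SL X m : F (X \<triangleright> m) \<rightarrow> X \<triangleright> F m\<close> and \<open>SR m Y : F (m \<triangleleft> Y) \<rightarrow> F m \<triangleleft> Y\<close>.
\<close>

locale bimodule_functor =
  fixes C :: "('c, 'cm, 'k::field) moncat"
    and D :: "('d, 'dm, 'k) moncat"
    and M :: "('o, 'm, 'k, 'c, 'cm, 'd, 'dm) bimod"
    and N :: "('p, 'n, 'k, 'c, 'cm, 'd, 'dm) bimod"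
    and FO :: "'o \<Rightarrow> 'p" and FA :: "'m \<Rightarrow> 'n"
    and SL :: "'c \<Rightarrow> 'o \<Rightarrow> 'n" and SR :: "'o \<Rightarrow> 'd \<Rightarrow> 'n"
  assumes linear: "linear_functor M N FO FA"
    and sl_iso: "\<lbrakk>X \<in> Ob C; m \<in> Ob M\<rbrakk>
          \<Longrightarrow> iso_arr N (FO (X \<triangleright>\<^bsub>M\<^esub> m)) (X \<triangleright>\<^bsub>N\<^esub> FO m) (SL X m)"
    and sl_nat: "\<lbrakk>f \<in> Arr C; h \<in> Arr M\<rbrakk>
          \<Longrightarrow> SL (Cod C f) (Cod M h) \<cdot>\<^bsub>N\<^esub> FA (LActA M f h)
              = LActA N f (FA h) \<cdot>\<^bsub>N\<^esub> SL (Dom C f) (Dom M h)"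
    and sr_iso: "\<lbrakk>m \<in> Ob M; P \<in> Ob D\<rbrakk>
          \<Longrightarrow> iso_arr N (FO (m \<triangleleft>\<^bsub>M\<^esub> P)) (FO m \<triangleleft>\<^bsub>N\<^esub> P) (SR m P)"
    and sr_nat: "\<lbrakk>h \<in> Arr M; v \<in> Arr D\<rbrakk>
          \<Longrightarrow> SR (Cod M h) (Cod D v) \<cdot>\<^bsub>N\<^esub> FA (RActA M h v)
              = RActA N (FA h) v \<cdot>\<^bsub>N\<^esub> SR (Dom M h) (Dom D v)"
    and left_assoc: "\<lbrakk>X \<in> Ob C; Y \<in> Ob C; m \<in> Ob M\<rbrakk>
          \<Longrightarrow> LAssoc N X Y (FO m) \<cdot>\<^bsub>N\<^esub> SL (X \<odot>\<^bsub>C\<^esub> Y) m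
              = LActA N (Id C X) (SL Y m) \<cdot>\<^bsub>N\<^esub> SL X (Y \<triangleright>\<^bsub>M\<^esub> m) \<cdot>\<^bsub>N\<^esub> FA (LAssoc M X Y m)"
    and left_unit: "m \<in> Ob M
          \<Longrightarrow> LUnitor N (FO m) \<cdot>\<^bsub>N\<^esub> SL (Unit C) m = FA (LUnitor M m)"
    and right_assoc: "\<lbrakk>m \<in> Ob M; P \<in> Ob D; Q \<in> Ob D\<rbrakk>
          \<Longrightarrow> RAssoc N (FO m) P Q \<cdot>\<^bsub>N\<^esub> RActA N (SR m P) (Id D Q) \<cdot>\<^bsub>N\<^esub> SR (m \<triangleleft>\<^bsub>M\<^esub> P) Q
              = SR m (P \<odot>\<^bsub>D\<^esub> Q) \<cdot>\<^bsub>N\<^esub> FA (RAssoc M m P Q)"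
    and right_unit: "m \<in> Ob M
          \<Longrightarrow> RUnitor N (FO m) \<cdot>\<^bsub>N\<^esub> SR m (Unit D) = FA (RUnitor M m)"
    and middle: "\<lbrakk>X \<in> Ob C; m \<in> Ob M; P \<in> Ob D\<rbrakk>
          \<Longrightarrow> MAssoc N X (FO m) P \<cdot>\<^bsub>N\<^esub> RActA N (SL X m) (Id D P) \<cdot>\<^bsub>N\<^esub> SR (X \<triangleright>\<^bsub>M\<^esub> m) P
              = LActA N (Id C X) (SR m P) \<cdot>\<^bsub>N\<^esub> SL X (m \<triangleleft>\<^bsub>M\<^esub> P) \<cdot>\<^bsub>N\<^esub> FA (MAssoc M X m P)"

definition bimodule_equivalent ::
  "('c, 'cm, 'k::field) moncat \<Rightarrow> ('d, 'dm, 'k) moncat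
    \<Rightarrow> ('o, 'm, 'k, 'c, 'cm, 'd, 'dm) bimod \<Rightarrow> ('p, 'n, 'k, 'c, 'cm, 'd, 'dm) bimod \<Rightarrow> bool" where
  "bimodule_equivalent C D M N \<longleftrightarrow>
     (\<exists>FO FA SL SR. bimodule_functor C D M N FO FA SL SR \<and> equivalence_functor M N FO FA)"


section \<open>Relative tensor products and invertible bimodule categories\<close>

text \<open>
  A balanced functor \<open>M \<times> N \<rightarrow> K\<close> is a bilinear functor with natural isomorphisms
  \<open>\<beta> m d n : B (m \<triangleleft> d) n \<rightarrow> B m (d \<triangleright> n)\<close>.
\<close>

locale balanced_functor =
  fixes D :: "('d, 'dm, 'k::field) moncat"
    and M :: "('o, 'm, 'k, 'c, 'cm, 'd, 'dm) bimod"
    and N :: "('p, 'n, 'k, 'd, 'dm, 'e, 'em) bimod"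
    and K :: "('q, 'r, 'k, 'z) lincat_scheme"
    and BO :: "'o \<Rightarrow> 'p \<Rightarrow> 'q" and BA :: "'m \<Rightarrow> 'n \<Rightarrow> 'r"
    and \<beta> :: "'o \<Rightarrow> 'd \<Rightarrow> 'p \<Rightarrow> 'r"
  assumes bilinear: "bilinear_functor M N K BO BA"
    and balance_iso: "\<lbrakk>m \<in> Ob M; d \<in> Ob D; n \<in> Ob N\<rbrakk>
          \<Longrightarrow> iso_arr K (BO (m \<triangleleft>\<^bsub>M\<^esub> d) n) (BO m (d \<triangleright>\<^bsub>N\<^esub> n)) (\<beta> m d n)"
    and balance_nat: "\<lbrakk>f \<in> Arr M; g \<in> Arr D; h \<in> Arr N\<rbrakk>
          \<Longrightarrow> \<beta> (Cod M f) (Cod D g) (Cod N h) \<cdot>\<^bsub>K\<^esub> BA (RActA M f g) h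
              = BA f (LActA N g h) \<cdot>\<^bsub>K\<^esub> \<beta> (Dom M f) (Dom D g) (Dom N h)"
    and balance_assoc: "\<lbrakk>m \<in> Ob M; d \<in> Ob D; d' \<in> Ob D; n \<in> Ob N\<rbrakk>
          \<Longrightarrow> \<beta> m d (d' \<triangleright>\<^bsub>N\<^esub> n) \<cdot>\<^bsub>K\<^esub> \<beta> (m \<triangleleft>\<^bsub>M\<^esub> d) d' n
              = BA (Id M m) (LAssoc N d d' n) \<cdot>\<^bsub>K\<^esub> \<beta> m (d \<odot>\<^bsub>D\<^esub> d') n
                  \<cdot>\<^bsub>K\<^esub> BA (RAssoc M m d d') (Id N n)"
    and balance_unit: "\<lbrakk>m \<in> Ob M; n \<in> Ob N\<rbrakk>
          \<Longrightarrow> BA (Id M m) (LUnitor N n) \<cdot>\<^bsub>K\<^esub> \<beta> m (Unit D) n = BA (RUnitor M m) (Id N n)"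

text \<open>
  The balanced functor is a functor of bimodule categories if it also comes with isomorphisms
  \<open>BL c m n : B (c \<triangleright> m) n \<rightarrow> c \<triangleright> B m n\<close> and \<open>BR m n e : B m (n \<triangleleft> e) \<rightarrow> B m n \<triangleleft> e\<close>.
\<close>

locale balanced_bimodule_functor = balanced_functor D M N K BO BA \<beta>
  for C :: "('c, 'cm, 'k::field) moncat"
    and D :: "('d, 'dm, 'k) moncat"
    and E :: "('e, 'em, 'k) moncat"
    and M :: "('o, 'm, 'k, 'c, 'cm, 'd, 'dm) bimod"
    and N :: "('p, 'n, 'k, 'd, 'dm, 'e, 'em) bimod"
    and K :: "('q, 'r, 'k, 'c, 'cm, 'e, 'em) bimod"
    and BO :: "'o \<Rightarrow> 'p \<Rightarrow> 'q" and BA :: "'m \<Rightarrow> 'n \<Rightarrow> 'r"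
    and \<beta> :: "'o \<Rightarrow> 'd \<Rightarrow> 'p \<Rightarrow> 'r"
    and BL :: "'c \<Rightarrow> 'o \<Rightarrow> 'p \<Rightarrow> 'r" and BR :: "'o \<Rightarrow> 'p \<Rightarrow> 'e \<Rightarrow> 'r" +
  assumes bl_iso: "\<lbrakk>c \<in> Ob C; m \<in> Ob M; n \<in> Ob N\<rbrakk>
          \<Longrightarrow> iso_arr K (BO (c \<triangleright>\<^bsub>M\<^esub> m) n) (c \<triangleright>\<^bsub>K\<^esub> BO m n) (BL c m n)"
    and bl_nat: "\<lbrakk>u \<in> Arr C; f \<in> Arr M; g \<in> Arr N\<rbrakk>
          \<Longrightarrow> BL (Cod C u) (Cod M f) (Cod N g) \<cdot>\<^bsub>K\<^esub> BA (LActA M u f) g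
              = LActA K u (BA f g) \<cdot>\<^bsub>K\<^esub> BL (Dom C u) (Dom M f) (Dom N g)"
    and bl_assoc: "\<lbrakk>c \<in> Ob C; c' \<in> Ob C; m \<in> Ob M; n \<in> Ob N\<rbrakk>
          \<Longrightarrow> LAssoc K c c' (BO m n) \<cdot>\<^bsub>K\<^esub> BL (c \<odot>\<^bsub>C\<^esub> c') m n
              = LActA K (Id C c) (BL c' m n) \<cdot>\<^bsub>K\<^esub> BL c (c' \<triangleright>\<^bsub>M\<^esub> m) n
                  \<cdot>\<^bsub>K\<^esub> BA (LAssoc M c c' m) (Id N n)"
    and bl_unit: "\<lbrakk>m \<in> Ob M; n \<in> Ob N\<rbrakk>
          \<Longrightarrow> LUnitor K (BO m n) \<cdot>\<^bsub>K\<^esub> BL (Unit C) m n = BA (LUnitor M m) (Id N n)"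
    and br_iso: "\<lbrakk>m \<in> Ob M; n \<in> Ob N; e \<in> Ob E\<rbrakk>
          \<Longrightarrow> iso_arr K (BO m (n \<triangleleft>\<^bsub>N\<^esub> e)) (BO m n \<triangleleft>\<^bsub>K\<^esub> e) (BR m n e)"
    and br_nat: "\<lbrakk>f \<in> Arr M; g \<in> Arr N; v \<in> Arr E\<rbrakk>
          \<Longrightarrow> BR (Cod M f) (Cod N g) (Cod E v) \<cdot>\<^bsub>K\<^esub> BA f (RActA N g v)
              = RActA K (BA f g) v \<cdot>\<^bsub>K\<^esub> BR (Dom M f) (Dom N g) (Dom E v)"
    and br_assoc: "\<lbrakk>m \<in> Ob M; n \<in> Ob N; e \<in> Ob E; e' \<in> Ob E\<rbrakk>
          \<Longrightarrow> RAssoc K (BO m n) e e' \<cdot>\<^bsub>K\<^esub> RActA K (BR m n e) (Id E e') \<cdot>\<^bsub>K\<^esub> BR m (n \<triangleleft>\<^bsub>N\<^esub> e) e'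
              = BR m n (e \<odot>\<^bsub>E\<^esub> e') \<cdot>\<^bsub>K\<^esub> BA (Id M m) (RAssoc N n e e')"
    and br_unit: "\<lbrakk>m \<in> Ob M; n \<in> Ob N\<rbrakk>
          \<Longrightarrow> RUnitor K (BO m n) \<cdot>\<^bsub>K\<^esub> BR m n (Unit E) = BA (Id M m) (RUnitor N n)"
    and bl_br: "\<lbrakk>c \<in> Ob C; m \<in> Ob M; n \<in> Ob N; e \<in> Ob E\<rbrakk>
          \<Longrightarrow> MAssoc K c (BO m n) e \<cdot>\<^bsub>K\<^esub> RActA K (BL c m n) (Id E e) \<cdot>\<^bsub>K\<^esub> BR (c \<triangleright>\<^bsub>M\<^esub> m) n e
              = LActA K (Id C c) (BR m n e) \<cdot>\<^bsub>K\<^esub> BL c m (n \<triangleleft>\<^bsub>N\<^esub> e)"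
    and bl_balance: "\<lbrakk>c \<in> Ob C; m \<in> Ob M; d \<in> Ob D; n \<in> Ob N\<rbrakk>
          \<Longrightarrow> BL c m (d \<triangleright>\<^bsub>N\<^esub> n) \<cdot>\<^bsub>K\<^esub> \<beta> (c \<triangleright>\<^bsub>M\<^esub> m) d n
              = LActA K (Id C c) (\<beta> m d n) \<cdot>\<^bsub>K\<^esub> BL c (m \<triangleleft>\<^bsub>M\<^esub> d) n
                  \<cdot>\<^bsub>K\<^esub> BA (MAssoc M c m d) (Id N n)"
    and br_balance: "\<lbrakk>m \<in> Ob M; d \<in> Ob D; n \<in> Ob N; e \<in> Ob E\<rbrakk>
          \<Longrightarrow> RActA K (\<beta> m d n) (Id E e) \<cdot>\<^bsub>K\<^esub> BR (m \<triangleleft>\<^bsub>M\<^esub> d) n e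
              = BR m (d \<triangleright>\<^bsub>N\<^esub> n) e \<cdot>\<^bsub>K\<^esub> BA (Id M m) (inv_arr N (MAssoc N d n e))
                  \<cdot>\<^bsub>K\<^esub> \<beta> m d (n \<triangleleft>\<^bsub>N\<^esub> e)"

text \<open>
  \<open>B : M \<times> N \<rightarrow> K\<close> exhibits \<open>K\<close> as \<open>M \<boxtimes>\<^sub>D N\<close> if, for every finite semisimple category \<open>K'\<close>,
  composition with \<open>B\<close> is an equivalence from the linear functors \<open>K \<rightarrow> K'\<close> to the balanced functors
  \<open>M \<times> N \<rightarrow> K'\<close>; the first clause is essential surjectivity, the second full faithfulness.  On finite
  semisimple categories exactness is automatic.  The categories \<open>K'\<close> live on the types of \<open>M\<close>, which
  is harmless as soon as every finite semisimple category has an equivalent copy there.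
\<close>

definition relative_tensor_product ::
  "('c, 'cm, 'k::field) moncat \<Rightarrow> ('d, 'dm, 'k) moncat \<Rightarrow> ('e, 'em, 'k) moncat
    \<Rightarrow> ('o, 'm, 'k, 'c, 'cm, 'd, 'dm) bimod \<Rightarrow> ('p, 'n, 'k, 'd, 'dm, 'e, 'em) bimod
    \<Rightarrow> ('q, 'r, 'k, 'c, 'cm, 'e, 'em) bimod \<Rightarrow> bool" where
  "relative_tensor_product C D E M N K \<longleftrightarrow>
     (\<exists>BO BA \<beta> BL BR. balanced_bimodule_functor C D E M N K BO BA \<beta> BL BR \<and>
       (\<forall>K' :: ('o, 'm, 'k) lincat. finite_semisimple K' \<longrightarrow>
          (\<forall>BO' BA' \<beta>'. balanced_functor D M N K' BO' BA' \<beta>' \<longrightarrow>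
             (\<exists>FO FA \<theta>. linear_functor K K' FO FA \<and>
                (\<forall>m \<in> Ob M. \<forall>n \<in> Ob N. iso_arr K' (FO (BO m n)) (BO' m n) (\<theta> m n)) \<and>
                (\<forall>f \<in> Arr M. \<forall>h \<in> Arr N.
                   \<theta> (Cod M f) (Cod N h) \<cdot>\<^bsub>K'\<^esub> FA (BA f h)
                     = BA' f h \<cdot>\<^bsub>K'\<^esub> \<theta> (Dom M f) (Dom N h)) \<and>
                (\<forall>m \<in> Ob M. \<forall>d \<in> Ob D. \<forall>n \<in> Ob N.
                   \<theta> m (d \<triangleright>\<^bsub>N\<^esub> n) \<cdot>\<^bsub>K'\<^esub> FA (\<beta> m d n) = \<beta>' m d n \<cdot>\<^bsub>K'\<^esub> \<theta> (m \<triangleleft>\<^bsub>M\<^esub> d) n))) \<and>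
          (\<forall>FO FA GO GA \<tau>. linear_functor K K' FO FA \<longrightarrow> linear_functor K K' GO GA \<longrightarrow>
             (\<forall>m \<in> Ob M. \<forall>n \<in> Ob N. \<tau> m n \<in> Hom K' (FO (BO m n)) (GO (BO m n))) \<longrightarrow>
             (\<forall>f \<in> Arr M. \<forall>h \<in> Arr N.
                \<tau> (Cod M f) (Cod N h) \<cdot>\<^bsub>K'\<^esub> FA (BA f h)
                  = GA (BA f h) \<cdot>\<^bsub>K'\<^esub> \<tau> (Dom M f) (Dom N h)) \<longrightarrow>
             (\<forall>m \<in> Ob M. \<forall>d \<in> Ob D. \<forall>n \<in> Ob N.
                \<tau> m (d \<triangleright>\<^bsub>N\<^esub> n) \<cdot>\<^bsub>K'\<^esub> FA (\<beta> m d n) = GA (\<beta> m d n) \<cdot>\<^bsub>K'\<^esub> \<tau> (m \<triangleleft>\<^bsub>M\<^esub> d) n) \<longrightarrow>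
             (\<exists>!\<eta>. \<eta> \<in> extensional (Ob K) \<and>
                (\<forall>x \<in> Ob K. \<eta> x \<in> Hom K' (FO x) (GO x)) \<and>
                (\<forall>f \<in> Arr K. \<eta> (Cod K f) \<cdot>\<^bsub>K'\<^esub> FA f = GA f \<cdot>\<^bsub>K'\<^esub> \<eta> (Dom K f)) \<and>
                (\<forall>m \<in> Ob M. \<forall>n \<in> Ob N. \<eta> (BO m n) = \<tau> m n)))))"

definition invertible_bimodule ::
  "('c, 'cm, 'k::field) moncat \<Rightarrow> ('o, 'm, 'k, 'c, 'cm, 'c, 'cm) bimod \<Rightarrow> bool" where
  "invertible_bimodule C M \<longleftrightarrow> bimodule_category C C M \<and>
     (\<exists>N :: ('o, 'm, 'k, 'c, 'cm, 'c, 'cm) bimod. bimodule_category C C N \<and>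
        relative_tensor_product C C C M N (regular_bimodule C) \<and>
        relative_tensor_product C C C N M (regular_bimodule C))"


section \<open>Graded vector spaces\<close>

text \<open>
  A finite-dimensional graded vector space is represented by the list of degrees of an ordered
  homogeneous basis, and linear maps by their matrices.  \<open>homogeneous G d V W P\<close> says that \<open>P\<close> sends
  the part of \<open>V\<close> of degree \<open>a\<close> to the part of \<open>W\<close> of degree \<open>a d\<close>.  Bases of tensor products are
  ordered lexicographically; this makes the tensor product strictly associative and unital.
\<close>

definition homogeneous ::
  "'a monoid \<Rightarrow> 'a \<Rightarrow> 'a list \<Rightarrow> 'a list \<Rightarrow> 'k::field mat \<Rightarrow> bool" where
  "homogeneous G d V W P \<longleftrightarrow> P \<in> carrier_mat (length W) (length V) \<and>
     (\<forall>i < length W. \<forall>j < length V. P $$ (i, j) \<noteq> 0 \<longrightarrow> W ! i = V ! j \<otimes>\<^bsub>G\<^esub> d)"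

definition kron :: "'k::field mat \<Rightarrow> 'k mat \<Rightarrow> 'k mat" where
  "kron A B = mat (dim_row A * dim_row B) (dim_col A * dim_col B)
     (\<lambda>(i, j). A $$ (i div dim_row B, j div dim_col B) * B $$ (i mod dim_row B, j mod dim_col B))"

definition convolve :: "('a \<Rightarrow> 'b \<Rightarrow> 'c) \<Rightarrow> 'a list \<Rightarrow> 'b list \<Rightarrow> 'c list" where
  "convolve f X Y = concat (map (\<lambda>x. map (f x) Y) X)"

definition Vect :: "'a monoid \<Rightarrow> ('a list, 'a list \<times> 'k::field mat \<times> 'a list, 'k) moncat" where
  "Vect G =
     (let tensor = convolve (monoid.mult G); ident = (\<lambda>X. 1\<^sub>m (length X)) in
     \<lparr>Ob = lists (carrier G),
      Arr = {(X, A, Y). X \<in> lists (carrier G) \<and> Y \<in> lists (carrier G) \<and>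
                        homogeneous G \<one>\<^bsub>G\<^esub> X Y A},
      Dom = (\<lambda>(X, A, Y). X),
      Cod = (\<lambda>(X, A, Y). Y),
      Id = (\<lambda>X. (X, ident X, X)),
      Comp = (\<lambda>(_, B, Z) (X, A, _). (X, B * A, Z)),
      Plus = (\<lambda>(X, A, Y) (_, B, _). (X, A + B, Y)),
      Scale = (\<lambda>a (X, A, Y). (X, a \<cdot>\<^sub>m A, Y)),
      TenO = tensor,
      TenA = (\<lambda>(X, A, Y) (X', A', Y'). (tensor X X', kron A A', tensor Y Y')),
      Unit = [\<one>\<^bsub>G\<^esub>],
      Assoc = (\<lambda>X Y Z. (tensor (tensor X Y) Z, ident (tensor (tensor X Y) Z),
                         tensor X (tensor Y Z))),
      LUnit = (\<lambda>X. (tensor [\<one>\<^bsub>G\<^esub>] X, ident X, X)),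
      RUnit = (\<lambda>X. (tensor X [\<one>\<^bsub>G\<^esub>], ident X, X))\<rparr>)"


section \<open>Correspondences and their linearisation\<close>

definition cocycle2 :: "'a monoid \<Rightarrow> 'a set \<Rightarrow> ('a \<Rightarrow> 'a \<Rightarrow> 'k::field) \<Rightarrow> bool" where
  "cocycle2 A C \<kappa> \<longleftrightarrow> (\<forall>a \<in> C. \<forall>b \<in> C. \<kappa> a b \<noteq> 0) \<and>
     (\<forall>a \<in> C. \<forall>b \<in> C. \<forall>c \<in> C.
        \<kappa> a b * \<kappa> (a \<otimes>\<^bsub>A\<^esub> b) c = \<kappa> a (b \<otimes>\<^bsub>A\<^esub> c) * \<kappa> b c)"

definition alt :: "('a \<Rightarrow> 'a \<Rightarrow> 'k::field) \<Rightarrow> 'a \<Rightarrow> 'a \<Rightarrow> 'k" where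
  "alt \<kappa> a b = \<kappa> a b * inverse (\<kappa> b a)"

text \<open>
  A correspondence \<open>BG \<leftarrow> (BC, \<kappa>) \<rightarrow> BH\<close> is a pair \<open>(C, \<kappa>)\<close> of a subgroup \<open>C\<close> of \<open>G \<times> H\<close> and a
  2-cocycle \<open>\<kappa>\<close> on \<open>C\<close>.
\<close>

type_synonym ('a, 'k) correspondence = "'a set \<times> ('a \<Rightarrow> 'a \<Rightarrow> 'k)"

type_synonym ('a, 'k) gmod = "'a list \<times> ('a \<Rightarrow> 'k mat)"

text \<open>
  The module category over \<open>Vect (A)\<close> classified by \<open>(C, alt \<kappa>)\<close> is that of right modules in
  \<open>Vect (A)\<close> over the twisted group algebra of \<open>C\<close>, with basis \<open>e\<^sub>c\<close> for \<open>c \<in> C\<close> and product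
  \<open>e\<^sub>c e\<^sub>d = \<kappa> c d e\<^sub>c\<^sub>d\<close> (so that its unit is \<open>(\<kappa> 1 1)\<^sup>-\<^sup>1 e\<^sub>1\<close>).  A module is a graded vector space
  \<open>V\<close> with the matrices \<open>\<rho> c\<close> of \<open>v \<mapsto> v e\<^sub>c\<close>.  Its simple objects correspond to the cosets of \<open>C\<close>
  in \<open>A\<close>.
\<close>

definition twisted_modules ::
  "'a monoid \<Rightarrow> ('a, 'k::field) correspondence \<Rightarrow> ('a, 'k) gmod set" where
  "twisted_modules A = (\<lambda>(C, \<kappa>).
     {(V, \<rho>). V \<in> lists (carrier A) \<and> \<rho> \<in> extensional C \<and>
        (\<forall>c \<in> C. homogeneous A c V V (\<rho> c)) \<and>
        \<rho> \<one>\<^bsub>A\<^esub> = \<kappa> \<one>\<^bsub>A\<^esub> \<one>\<^bsub>A\<^esub> \<cdot>\<^sub>m 1\<^sub>m (length V) \<and>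
        (\<forall>c \<in> C. \<forall>d \<in> C. \<rho> d * \<rho> c = \<kappa> c d \<cdot>\<^sub>m \<rho> (c \<otimes>\<^bsub>A\<^esub> d))})"

text \<open>
  \<open>Sum3\<close> regards this \<open>Vect (G \<times> H)\<close>-module category as a bimodule category: a homogeneous line of
  degree \<open>\<ell>\<close> on the left and one of degree \<open>k\<close> on the right act together as the line of degree
  \<open>(\<ell>, k\<^sup>-\<^sup>1)\<close>.  Writing the right factor on the right of \<open>V\<close> makes all associators identities.
\<close>

definition Sum3 ::
  "'g monoid \<Rightarrow> 'h monoid \<Rightarrow> ('g \<times> 'h, 'k::field) correspondence
    \<Rightarrow> (('g \<times> 'h, 'k) gmod, ('g \<times> 'h, 'k) gmod \<times> 'k mat \<times> ('g \<times> 'h, 'k) gmod, 'k,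
        'g list, 'g list \<times> 'k mat \<times> 'g list, 'h list, 'h list \<times> 'k mat \<times> 'h list) bimod" where
  "Sum3 G H K =
     (let A = G \<times>\<times> H; C = fst K; Mods = twisted_modules A K;
          tensG = convolve (monoid.mult G); tensH = convolve (monoid.mult H);
          ident = (\<lambda>(V, \<rho>). 1\<^sub>m (length V));
          lact = (\<lambda>X (V, \<rho>). (convolve (\<lambda>x (v, w). (x \<otimes>\<^bsub>G\<^esub> v, w)) X V,
                              \<lambda>c\<in>C. kron (1\<^sub>m (length X)) (\<rho> c)));
          ract = (\<lambda>(V, \<rho>) Y. (convolve (\<lambda>(v, w) y. (v, w \<otimes>\<^bsub>H\<^esub> inv\<^bsub>H\<^esub> y)) V Y,
                              \<lambda>c\<in>C. kron (\<rho> c) (1\<^sub>m (length Y))))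
      in
     \<lparr>Ob = Mods,
      Arr = {(m, F, n). m \<in> Mods \<and> n \<in> Mods \<and> homogeneous A \<one>\<^bsub>A\<^esub> (fst m) (fst n) F \<and>
                        (\<forall>c \<in> C. F * snd m c = snd n c * F)},
      Dom = (\<lambda>(m, F, n). m),
      Cod = (\<lambda>(m, F, n). n),
      Id = (\<lambda>m. (m, ident m, m)),
      Comp = (\<lambda>(_, F', p) (m, F, _). (m, F' * F, p)),
      Plus = (\<lambda>(m, F, n) (_, F', _). (m, F + F', n)),
      Scale = (\<lambda>a (m, F, n). (m, a \<cdot>\<^sub>m F, n)),
      LActO = lact,
      LActA = (\<lambda>(X, P, X') (m, F, n). (lact X m, kron P F, lact X' n)),
      RActO = ract,
      RActA = (\<lambda>(m, F, n) (Y, P, Y'). (ract m Y, kron F P, ract n Y')),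
      LAssoc = (\<lambda>X Y m. (lact (tensG X Y) m, ident (lact (tensG X Y) m), lact X (lact Y m))),
      LUnitor = (\<lambda>m. (lact [\<one>\<^bsub>G\<^esub>] m, ident m, m)),
      RAssoc = (\<lambda>m X Y. (ract (ract m X) Y, ident (ract (ract m X) Y), ract m (tensH X Y))),
      RUnitor = (\<lambda>m. (ract m [\<one>\<^bsub>H\<^esub>], ident m, m)),
      MAssoc = (\<lambda>X m Y. (ract (lact X m) Y, ident (ract (lact X m) Y), lact X (ract m Y)))\<rparr>)"


section \<open>The map from the orthogonal group\<close>

definition units_group :: "'k::field monoid" where
  "units_group = \<lparr>carrier = {x. x \<noteq> 0}, monoid.mult = (*), one = 1\<rparr>"

definition dual :: "'l monoid \<Rightarrow> ('l \<Rightarrow> 'k::field) monoid" where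
  "dual L = \<lparr>carrier = hom L units_group \<inter> extensional (carrier L),
             monoid.mult = (\<lambda>\<phi> \<psi>. \<lambda>l\<in>carrier L. \<phi> l * \<psi> l),
             one = (\<lambda>l\<in>carrier L. 1)\<rparr>"

definition ev :: "'l \<times> ('l \<Rightarrow> 'k) \<Rightarrow> 'k" where
  "ev = (\<lambda>(l, \<phi>). \<phi> l)"

definition orthogonal_group ::
  "'l monoid \<Rightarrow> ('l \<times> ('l \<Rightarrow> 'k::field) \<Rightarrow> 'l \<times> ('l \<Rightarrow> 'k)) monoid" where
  "orthogonal_group L =
     AutoGroup (L \<times>\<times> dual L)
       \<lparr>carrier := {g \<in> auto (L \<times>\<times> dual L). \<forall>x \<in> carrier (L \<times>\<times> dual L). ev (g x) = ev x}\<rparr>"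

definition T_sigma ::
  "'l monoid \<Rightarrow> ('l \<Rightarrow> 'l \<Rightarrow> 'k::field) \<Rightarrow> 'l \<times> ('l \<Rightarrow> 'k) \<Rightarrow> 'l \<times> ('l \<Rightarrow> 'k)" where
  "T_sigma L \<sigma> = (\<lambda>(l, \<phi>)\<in>carrier (L \<times>\<times> dual L). (inv_into (carrier L) \<sigma> \<phi>, \<sigma> l))"

definition graph_projection ::
  "'l monoid \<Rightarrow> ('l \<times> ('l \<Rightarrow> 'k::field) \<Rightarrow> 'l \<times> ('l \<Rightarrow> 'k)) \<Rightarrow> ('l \<times> 'l) set" where
  "graph_projection L g = (\<lambda>x. (fst x, fst (g x))) ` carrier (L \<times>\<times> dual L)"

definition chi ::
  "'l monoid \<Rightarrow> ('l \<times> ('l \<Rightarrow> 'k::field) \<Rightarrow> 'l \<times> ('l \<Rightarrow> 'k)) \<Rightarrow> 'l \<times> 'l \<Rightarrow> 'l \<times> 'l \<Rightarrow> 'k" where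
  "chi L g = (\<lambda>(l1, k1) (l2, k2).
     let \<phi> = (SOME \<phi>. \<phi> \<in> carrier (dual L) \<and> fst (g (l1, \<phi>)) = k1);
         \<psi> = snd (g (l1, \<phi>))
     in \<phi> l2 * inverse (\<psi> k2))"

text \<open>
  The value of \<open>chi L g\<close> does not depend on the choice of \<open>\<phi>\<close> because the graph of \<open>g\<close> is isotropic,
  and \<open>\<kappa>\<close> in \<open>C_corr\<close> is unique up to coboundaries because \<open>alt\<close> is injective on cohomology.
\<close>

definition C_corr ::
  "'l monoid \<Rightarrow> ('l \<times> ('l \<Rightarrow> 'k::field) \<Rightarrow> 'l \<times> ('l \<Rightarrow> 'k)) \<Rightarrow> ('l \<times> 'l, 'k) correspondence" where
  "C_corr L g =
     (graph_projection L g,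
      SOME \<kappa>. cocycle2 (L \<times>\<times> L) (graph_projection L g) \<kappa> \<and>
        (\<forall>x \<in> graph_projection L g. \<forall>y \<in> graph_projection L g. alt \<kappa> x y = chi L g x y))"

text \<open>
  Equivalence classes of invertible \<open>Vect L\<close>-bimodule categories are taken among those on the types
  of objects and arrows used by \<open>Sum3\<close>; every finite semisimple category is equivalent to one on
  these types (objects: lists of simple constituents, arrows: matrices).  For an invertible \<open>M\<close>,
  possibly on other types, \<open>bimodule_class L M\<close> is its class, an element of \<open>pi0_Aut L\<close>.
\<close>

type_synonym ('l, 'k) vect_bimod =
  "(('l \<times> 'l, 'k) gmod, ('l \<times> 'l, 'k) gmod \<times> 'k mat \<times> ('l \<times> 'l, 'k) gmod, 'k,
    'l list, 'l list \<times> 'k mat \<times> 'l list, 'l list, 'l list \<times> 'k mat \<times> 'l list) bimod"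

definition bimodule_class ::
  "'l monoid \<Rightarrow> ('o, 'm, 'k::field, 'l list, 'l list \<times> 'k mat \<times> 'l list,
                 'l list, 'l list \<times> 'k mat \<times> 'l list) bimod
    \<Rightarrow> ('l, 'k) vect_bimod set" where
  "bimodule_class L M = {N. invertible_bimodule (Vect L) N \<and> bimodule_equivalent (Vect L) (Vect L) N M}"

definition pi0_Aut :: "'l monoid \<Rightarrow> ('l, 'k::field) vect_bimod set set" where
  "pi0_Aut L = bimodule_class L ` {M :: ('l, 'k) vect_bimod. invertible_bimodule (Vect L) M}"

definition f_map ::
  "'l monoid \<Rightarrow> ('l \<times> ('l \<Rightarrow> 'k::field) \<Rightarrow> 'l \<times> ('l \<Rightarrow> 'k)) \<Rightarrow> ('l, 'k) vect_bimod set" where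
  "f_map L g = bimodule_class L (Sum3 L L (C_corr L g))"


section \<open>The Fourier transform\<close>

definition kappa_ev :: "'l \<times> ('l \<Rightarrow> 'k) \<Rightarrow> 'l \<times> ('l \<Rightarrow> 'k) \<Rightarrow> 'k" where
  "kappa_ev = (\<lambda>(l, \<phi>) (k, \<psi>). \<psi> l)"

definition FT_pt where
  "FT_pt (L :: 'l monoid) =
     Sum3 L (dual L) (carrier (L \<times>\<times> dual L), kappa_ev :: 'l \<times> ('l \<Rightarrow> 'k::field) \<Rightarrow> _)"

text \<open>
  Restriction of the right action along the strict monoidal functor \<open>Vect G \<rightarrow> Vect H\<close> induced by
  \<open>h \<in> hom G H\<close>, which applies \<open>h\<close> to degrees.
\<close>

definition restrict_right ::
  "('g \<Rightarrow> 'h) \<Rightarrow> ('o, 'm, 'k, 'c, 'cm, 'h list, 'h list \<times> 'k mat \<times> 'h list) bimod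
    \<Rightarrow> ('o, 'm, 'k, 'c, 'cm, 'g list, 'g list \<times> 'k mat \<times> 'g list) bimod" where
  "restrict_right h M =
     \<lparr>Ob = Ob M, Arr = Arr M, Dom = Dom M, Cod = Cod M, Id = Id M, Comp = Comp M,
      Plus = Plus M, Scale = Scale M, LActO = LActO M, LActA = LActA M,
      RActO = (\<lambda>m Y. RActO M m (map h Y)),
      RActA = (\<lambda>F (Y, P, Y'). RActA M F (map h Y, P, map h Y')),
      LAssoc = LAssoc M, LUnitor = LUnitor M,
      RAssoc = (\<lambda>m X Y. RAssoc M m (map h X) (map h Y)),
      RUnitor = RUnitor M,
      MAssoc = (\<lambda>X m Y. MAssoc M X m (map h Y))\<rparr>"

text \<open>
  The identification of \<open>L\<close> with its dual is \<open>k \<mapsto> \<sigma> (k\<^sup>-\<^sup>1)\<close>.  Lemma \<open>alt_kappa_ev_transport\<close> below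
  shows that the alternating bicharacter on \<open>L \<times> L\<close> obtained in this way is
  \<open>((l1, k1), (l2, k2)) \<mapsto> \<sigma>(k2)(l1)\<^sup>-\<^sup>1 \<sigma>(k1)(l2)\<close>; without the inversion it is the inverse of this.
\<close>

definition FT_sigma where
  "FT_sigma (L :: 'l monoid) (\<sigma> :: 'l \<Rightarrow> 'l \<Rightarrow> 'k::field) =
     restrict_right (\<lambda>k. \<sigma> (inv\<^bsub>L\<^esub> k)) (FT_pt L)"

lemma alt_kappa_ev_transport:
  fixes \<sigma> :: "'l \<Rightarrow> 'l \<Rightarrow> 'k::field"
  assumes "comm_group L" and "\<sigma> \<in> iso L (dual L)"
    and "l1 \<in> carrier L" "k1 \<in> carrier L" "l2 \<in> carrier L" "k2 \<in> carrier L"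
  shows "alt kappa_ev (l1, \<sigma> (inv\<^bsub>L\<^esub> k1)) (l2, \<sigma> (inv\<^bsub>L\<^esub> k2)) = inverse (\<sigma> k2 l1) * \<sigma> k1 l2"
proof -
  interpret comm_group L by fact
  have hom: "\<sigma> (a \<otimes>\<^bsub>L\<^esub> b) l = \<sigma> a l * \<sigma> b l" and nz: "\<sigma> a l \<noteq> 0"
    if "a \<in> carrier L" "b \<in> carrier L" "l \<in> carrier L" for a b l
    using assms(2) that by (auto simp: iso_def hom_def dual_def units_group_def)
  have one: "\<sigma> \<one>\<^bsub>L\<^esub> l = 1" if "l \<in> carrier L" for l
    using hom[of "\<one>\<^bsub>L\<^esub>" "\<one>\<^bsub>L\<^esub>" l] nz[of "\<one>\<^bsub>L\<^esub>" "\<one>\<^bsub>L\<^esub>" l] that by auto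
  have inv: "\<sigma> (inv\<^bsub>L\<^esub> a) l = inverse (\<sigma> a l)" if "a \<in> carrier L" "l \<in> carrier L" for a l
    using hom[of a "inv\<^bsub>L\<^esub> a" l] one[of l] that
    by (simp add: inverse_unique)
  show ?thesis
    using assms by (simp add: alt_def kappa_ev_def inv)
qed

end

theory Submission
  imports Defs "HOL-Algebra.Multiplicative_Group"
begin

text \<open>
  The graph of \<open>T\<^sub>\<sigma>\<close> projects onto all of \<open>L \<times> L\<close>, and its alternating bicharacter is the one of
  the transported Heisenberg cocycle \<open>((l1, k1), (l2, k2)) \<mapsto> \<sigma>(k2)(l1)\<^sup>-\<^sup>1\<close>.  The cocycle chosen in \<open>C_corr\<close>
  therefore differs from it by a symmetric cocycle, which is a coboundary because the units of an
  algebraically closed field are divisible.  A coboundary \<open>\<nu>\<close> only rescales the action of the basis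
  vectors \<open>e\<^sub>c\<close> of the twisted group algebra, so rescaling by \<open>\<nu>\<close> and relabelling degrees along
  \<open>k \<mapsto> \<sigma> (k\<^sup>-\<^sup>1)\<close> is an isomorphism between the two bimodule categories that preserves all the structure
  strictly.  Strict isomorphisms can be composed with any equivalence without coherence problems,
  which also identifies the two equivalence classes.
\<close>

section \<open>Symmetric cocycles\<close>

text \<open>The cocycle in \<open>C_corr\<close> is picked by \<open>SOME\<close>: nothing is known
  of it beyond the cocycle identity and its alternating bicharacter. The comparison must therefore
  use injectivity of \<open>alt\<close> on cohomology, and the resulting coboundary has no formula.
  Since the chosen cocycle is not known to be normalised, factors \<open>\<kappa> 1 1\<close> run
  through the extension argument. A value of \<open>f_map\<close> is a set of categories
  \<open>N\<close>, so equality of two values asks that an equivalence from an arbitrary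
  \<open>N\<close> into one category yield one into the other, both ways. The reverse direction
  needs no inversion of an equivalence: being cohomologous is symmetric, so the same construction
  gives a second strict isomorphism. The inversion in the relabelling fixes a sign. At
  \<open>T_sigma\<close> the characters in \<open>chi\<close> are \<sigma>(k1) and \<sigma>(l1),
  whereas the Heisenberg cocycle pulled back along \<sigma> alone has the inverse of
  \<open>chi\<close> as its alternating bicharacter.\<close>

lemma (in comm_group) extend_character:
  fixes \<chi> :: "'a \<Rightarrow> 'k::alg_closed_field"
  assumes H: "subgroup H G" and x: "x \<in> carrier G"
    and torsion: "m > 0" "x [^] (m::nat) \<in> H"
    and nz: "\<And>h. h \<in> H \<Longrightarrow> \<chi> h \<noteq> 0"
    and hom: "\<And>h h'. h \<in> H \<Longrightarrow> h' \<in> H \<Longrightarrow> \<chi> (h \<otimes> h') = \<chi> h * \<chi> h'"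
  obtains H' \<chi>' where "subgroup H' G" "H \<subseteq> H'" "x \<in> H'"
    "\<And>h. h \<in> H' \<Longrightarrow> \<chi>' h \<noteq> (0::'k)"
    "\<And>h h'. h \<in> H' \<Longrightarrow> h' \<in> H' \<Longrightarrow> \<chi>' (h \<otimes> h') = \<chi>' h * \<chi>' h'"
    "\<And>h. h \<in> H \<Longrightarrow> \<chi>' h = \<chi> h"
proof -
  interpret H: subgroup H G by (rule H)
  have Hc: "h \<in> carrier G" if "h \<in> H" for h
    using that H.subset by auto
  \<comment> \<open>\<open>n\<close> is the order of \<open>x\<close> modulo \<open>H\<close>. The
    only constraint on a value \<open>c\<close> at \<open>x\<close> is that its \<open>n\<close>-th
    power be the prescribed value at \<open>x [^] n\<close>, so an \<open>n\<close>-th root is all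
    that is needed.\<close>
  define n where "n = (LEAST n::nat. 0 < n \<and> x [^] n \<in> H)"
  have n: "0 < n \<and> x [^] n \<in> H"
    unfolding n_def by (rule LeastI[of _ m]) (use torsion in auto)
  have n_least: "n \<le> i" if "0 < i" "x [^] i \<in> H" for i :: nat
    unfolding n_def by (rule Least_le) (use that in auto)
  obtain c where c: "c ^ n = \<chi> (x [^] n)"
    using nth_root_exists[of n] n by blast
  have c0: "c \<noteq> 0"
    using c nz n by (metis zero_power)
  have \<chi>_one: "\<chi> \<one> = 1"
    using hom[of \<one> \<one>] nz[of \<one>] by simp
  have pow_H: "(x [^] n) [^] q \<in> H \<and> \<chi> ((x [^] n) [^] q) = c ^ (n * q)" for q :: nat
  proof (induction q)
    case 0
    show ?case using \<chi>_one by simp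
  next
    case (Suc q)
    then show ?case using n hom c by (auto simp: power_add)
  qed
  \<comment> \<open>\<open>n\<close> divides every such \<open>d\<close>: otherwise
    \<open>d mod n\<close> would be a smaller positive exponent with power in
    \<open>H\<close>.\<close>
  have \<chi>_pow: "\<chi> (x [^] d) = c ^ d" if d: "x [^] d \<in> H" for d :: nat
  proof -
    have split: "x [^] d = (x [^] n) [^] (d div n) \<otimes> x [^] (d mod n)"
      using x by (simp add: nat_pow_pow nat_pow_mult)
    have "x [^] (d mod n) = inv ((x [^] n) [^] (d div n)) \<otimes> x [^] d"
      unfolding split using x by (simp add: m_assoc[symmetric])
    then have "x [^] (d mod n) \<in> H"
      using d pow_H by simp
    then have "d mod n = 0"
      using n_least[of "d mod n"] n by (meson leD mod_less_divisor neq0_conv)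
    then have "d = n * (d div n)" by auto
    moreover have "\<chi> (x [^] d) = \<chi> ((x [^] n) [^] (d div n))"
      using split \<open>d mod n = 0\<close> x by simp
    ultimately show ?thesis using pow_H by simp
  qed
  \<comment> \<open>Exponents are natural numbers, so the smaller power of \<open>x\<close> is
    cancelled; the remaining \<open>x [^] (j - i)\<close> lies in \<open>H\<close>, where its value
    is already known.\<close>
  have wd_le: "\<chi> h * c ^ i = \<chi> h' * c ^ j"
    if "h \<in> H" "h' \<in> H" "h \<otimes> x [^] i = h' \<otimes> x [^] j" "i \<le> j" for h h' and i j :: nat
  proof -
    have *: "h \<otimes> x [^] i = (h' \<otimes> x [^] (j - i)) \<otimes> x [^] i"
      using that x Hc by (simp add: m_assoc nat_pow_mult)
    have h: "h = h' \<otimes> x [^] (j - i)"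
      using * that x Hc right_cancel[of h "x [^] i" "h' \<otimes> x [^] (j - i)"] by simp
    then have "x [^] (j - i) = inv h' \<otimes> h"
      using that x Hc by (simp add: m_assoc[symmetric])
    then have "x [^] (j - i) \<in> H" using that by simp
    then have "\<chi> h = \<chi> h' * c ^ (j - i)"
      using h that hom \<chi>_pow by simp
    then show ?thesis using \<open>i \<le> j\<close> by (simp add: mult.assoc flip: power_add)
  qed
  have wd: "\<chi> h * c ^ i = \<chi> h' * c ^ j"
    if "h \<in> H" "h' \<in> H" "h \<otimes> x [^] i = h' \<otimes> x [^] j" for h h' and i j :: nat
    using wd_le[of h h' i j] wd_le[of h' h j i] that by (cases "i \<le> j") auto
  define H' where "H' = {h \<otimes> x [^] i | h i. h \<in> H \<and> i \<in> (UNIV :: nat set)}"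
  define \<chi>' where "\<chi>' y = (SOME z. \<exists>h \<in> H. \<exists>i::nat. y = h \<otimes> x [^] i \<and> z = \<chi> h * c ^ i)" for y
  have \<chi>': "\<chi>' (h \<otimes> x [^] i) = \<chi> h * c ^ i" if "h \<in> H" for h and i :: nat
  proof -
    have "\<exists>h' \<in> H. \<exists>j::nat. h \<otimes> x [^] i = h' \<otimes> x [^] j \<and> \<chi>' (h \<otimes> x [^] i) = \<chi> h' * c ^ j"
      unfolding \<chi>'_def by (rule someI_ex) (use that in blast)
    then show ?thesis using wd that by metis
  qed
  have prod: "(h \<otimes> x [^] i) \<otimes> (h' \<otimes> x [^] j) = (h \<otimes> h') \<otimes> x [^] (i + j)"
    if "h \<in> H" "h' \<in> H" for h h' and i j :: nat
    using that x Hc by (simp add: m_ac flip: nat_pow_mult)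
  have inv_H': "inv (h \<otimes> x [^] i) \<in> H'" if h: "h \<in> H" for h and i :: nat
  proof -
    \<comment> \<open>As \<open>x [^] (n * i)\<close> lies in \<open>H\<close>, the inverse of
      \<open>x [^] i\<close> is an element of \<open>H\<close> times
      \<open>x [^] (n * i - i)\<close>. The subtraction is not truncated because \<open>n\<close> is
      positive.\<close>
    have "(h \<otimes> x [^] i) \<otimes> ((inv h \<otimes> inv ((x [^] n) [^] i)) \<otimes> x [^] (n * i - i)) = \<one>"
    proof -
      have "i + (n * i - i) = n * i" using n by simp
      then show ?thesis
        using prod[of h "inv h \<otimes> inv ((x [^] n) [^] i)" i "n * i - i"] h pow_H x Hc
        by (simp add: nat_pow_pow m_assoc[symmetric])
    qed
    then have "inv (h \<otimes> x [^] i) = (inv h \<otimes> inv ((x [^] n) [^] i)) \<otimes> x [^] (n * i - i)"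
      using h Hc x by (intro comm_inv_char) auto
    moreover have "inv h \<otimes> inv ((x [^] n) [^] i) \<in> H"
      using h pow_H by simp
    ultimately show ?thesis unfolding H'_def by blast
  qed
  show thesis
  proof
    show "subgroup H' G"
    proof
      show "H' \<subseteq> carrier G"
        using x Hc by (auto simp: H'_def)
      show "a \<otimes> b \<in> H'" if "a \<in> H'" "b \<in> H'" for a b
        using that prod unfolding H'_def by simp (metis H.m_closed)
      show "\<one> \<in> H'"
        unfolding H'_def using H.one_closed
        by (auto intro!: exI[of _ \<one>] exI[of _ "0::nat"])
      show "inv a \<in> H'" if "a \<in> H'" for a
        using that inv_H' unfolding H'_def by blast
    qed
    show "H \<subseteq> H'"
    proof
      fix h assume "h \<in> H"
      then show "h \<in> H'"
        unfolding H'_def by (auto intro!: exI[of _ h] exI[of _ "0::nat"] simp: Hc)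
    qed
    show "x \<in> H'"
      unfolding H'_def using x by (auto intro!: exI[of _ \<one>] exI[of _ "1::nat"])
    show "\<chi>' a \<noteq> 0" if "a \<in> H'" for a
      using that nz c0 by (auto simp: H'_def \<chi>')
    show "\<chi>' (a \<otimes> b) = \<chi>' a * \<chi>' b" if "a \<in> H'" "b \<in> H'" for a b
      using that by (auto simp: H'_def \<chi>' prod hom power_add)
    show "\<chi>' h = \<chi> h" if "h \<in> H" for h
      using \<chi>'[of h 0] that Hc by simp
  qed
qed

text \<open>
  The abelian extension of \<open>A\<close> by the units of \<open>k\<close> given by the cocycle is split because characters
  extend along it, the units of an algebraically closed field being divisible.
\<close>

definition cocycle_extension :: "'a monoid \<Rightarrow> ('a \<Rightarrow> 'a \<Rightarrow> 'k::field) \<Rightarrow> ('k \<times> 'a) monoid" where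
  "cocycle_extension A \<kappa> =
     \<lparr>carrier = {z. z \<noteq> 0} \<times> carrier A,
      monoid.mult = (\<lambda>(z, a) (w, b). (z * w * \<kappa> a b, a \<otimes>\<^bsub>A\<^esub> b)),
      one = (inverse (\<kappa> \<one>\<^bsub>A\<^esub> \<one>\<^bsub>A\<^esub>), \<one>\<^bsub>A\<^esub>)\<rparr>"

text \<open>The cocycle identity at \<open>(1, 1, a)\<close>, with \<open>\<kappa> 1 a\<close>
  cancelled. It replaces normalisation when the unit of the extension is checked.\<close>

lemma cocycle2_one_left:
  assumes "group A" "cocycle2 A (carrier A) \<kappa>" "a \<in> carrier A"
  shows "\<kappa> \<one>\<^bsub>A\<^esub> a = \<kappa> \<one>\<^bsub>A\<^esub> \<one>\<^bsub>A\<^esub>"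
proof -
  interpret group A by fact
  have "\<kappa> \<one>\<^bsub>A\<^esub> \<one>\<^bsub>A\<^esub> * \<kappa> (\<one>\<^bsub>A\<^esub> \<otimes>\<^bsub>A\<^esub> \<one>\<^bsub>A\<^esub>) a = \<kappa> \<one>\<^bsub>A\<^esub> (\<one>\<^bsub>A\<^esub> \<otimes>\<^bsub>A\<^esub> a) * \<kappa> \<one>\<^bsub>A\<^esub> a" "\<kappa> \<one>\<^bsub>A\<^esub> a \<noteq> 0"
    using assms unfolding cocycle2_def by blast+
  then show ?thesis using assms(3) by simp
qed

text \<open>Associativity is the cocycle identity, and commutativity is the symmetry of
  \<open>\<kappa>\<close>.\<close>

lemma comm_group_cocycle_extension:
  assumes A: "comm_group A" and \<kappa>: "cocycle2 A (carrier A) \<kappa>"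
    and sym: "\<And>a b. a \<in> carrier A \<Longrightarrow> b \<in> carrier A \<Longrightarrow> \<kappa> a b = \<kappa> b a"
  shows "comm_group (cocycle_extension A \<kappa>)"
proof -
  interpret comm_group A by fact
  have nz: "\<kappa> a b \<noteq> 0" if "a \<in> carrier A" "b \<in> carrier A" for a b
    using \<kappa> that by (simp add: cocycle2_def)
  have coc: "\<kappa> a b * \<kappa> (a \<otimes>\<^bsub>A\<^esub> b) c = \<kappa> a (b \<otimes>\<^bsub>A\<^esub> c) * \<kappa> b c"
    if "a \<in> carrier A" "b \<in> carrier A" "c \<in> carrier A" for a b c
    using \<kappa> that by (simp add: cocycle2_def)
  note one_left = cocycle2_one_left[OF group_axioms \<kappa>]
  show ?thesis
  proof (rule comm_groupI, goal_cases)
    case (1 x y)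
    then show ?case by (auto simp: cocycle_extension_def nz)
  next
    case 2
    show ?case by (simp add: cocycle_extension_def nz)
  next
    case (3 x y z)
    then show ?case
      using coc by (auto simp: cocycle_extension_def m_assoc)
  next
    case (4 x y)
    then show ?case
      by (auto simp: cocycle_extension_def m_comm sym)
  next
    case (5 x)
    then show ?case
      using one_left[of "snd x"] by (auto simp: cocycle_extension_def nz)
  next
    case (6 x)
    obtain z a where x: "x = (z, a)" "z \<noteq> 0" "a \<in> carrier A"
      using 6 by (auto simp: cocycle_extension_def)
    show ?case
      \<comment> \<open>The first entry solves
        \<open>w * z * \<kappa> (inv a) a = inverse (\<kappa> 1 1)\<close>, the right side being the
        first entry of the unit.\<close>
      by (rule bexI[of _ "(inverse (z * \<kappa> (inv\<^bsub>A\<^esub> a) a * \<kappa> \<one>\<^bsub>A\<^esub> \<one>\<^bsub>A\<^esub>), inv\<^bsub>A\<^esub> a)"])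
        (use x nz in \<open>auto simp: cocycle_extension_def field_simps\<close>)
  qed
qed

text \<open>A character of the extension that equals \<open>\<chi>0\<close> on the copy
  \<open>K\<close> of the units is a splitting, and \<open>\<nu> a\<close> is its value at the lift
  \<open>(1, a)\<close>. Finiteness of \<open>A\<close> makes the extension torsion modulo
  \<open>K\<close> and lets the lifts be adjoined one by one.\<close>

lemma symmetric_cocycle_is_coboundary:
  fixes \<kappa> :: "'a \<Rightarrow> 'a \<Rightarrow> 'k::alg_closed_field"
  assumes A: "comm_group A" and fin: "finite (carrier A)"
    and \<kappa>: "cocycle2 A (carrier A) \<kappa>"
    and sym: "\<And>a b. a \<in> carrier A \<Longrightarrow> b \<in> carrier A \<Longrightarrow> \<kappa> a b = \<kappa> b a"
  obtains \<nu> where "\<And>a. a \<in> carrier A \<Longrightarrow> \<nu> a \<noteq> 0"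
    "\<And>a b. a \<in> carrier A \<Longrightarrow> b \<in> carrier A \<Longrightarrow> \<nu> a * \<nu> b = \<kappa> a b * \<nu> (a \<otimes>\<^bsub>A\<^esub> b)"
proof -
  interpret A: comm_group A by (rule A)
  define E where "E = cocycle_extension A \<kappa>"
  interpret E: comm_group E
    unfolding E_def by (rule comm_group_cocycle_extension[OF A \<kappa> sym])
  have nz: "\<kappa> a b \<noteq> 0" if "a \<in> carrier A" "b \<in> carrier A" for a b
    using \<kappa> that by (simp add: cocycle2_def)
  note one_left = cocycle2_one_left[OF A.group_axioms \<kappa>]
  define K :: "('k \<times> 'a) set" where "K = {z. z \<noteq> 0} \<times> {\<one>\<^bsub>A\<^esub>}"
  \<comment> \<open>In the extension \<open>(z, 1) (w, 1) = (z w \<kappa> 1 1, 1)\<close>; the extra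
    factor makes \<open>\<chi>0\<close> multiplicative on \<open>K\<close>.\<close>
  define \<chi>0 :: "'k \<times> 'a \<Rightarrow> 'k" where "\<chi>0 = (\<lambda>(z, a). z * \<kappa> \<one>\<^bsub>A\<^esub> \<one>\<^bsub>A\<^esub>)"
  have K: "subgroup K E"
  proof (rule E.subgroupI)
    show "K \<subseteq> carrier E" "K \<noteq> {}"
      by (auto simp: K_def E_def cocycle_extension_def intro: exI[of _ 1])
    show "x \<otimes>\<^bsub>E\<^esub> y \<in> K" if "x \<in> K" "y \<in> K" for x y
      using that nz by (auto simp: K_def E_def cocycle_extension_def)
    show "inv\<^bsub>E\<^esub> x \<in> K" if x: "x \<in> K" for x
    proof -
      obtain z where z: "x = (z, \<one>\<^bsub>A\<^esub>)" "z \<noteq> 0" using x by (auto simp: K_def)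
      let ?k = "\<kappa> \<one>\<^bsub>A\<^esub> \<one>\<^bsub>A\<^esub>"
      have "inv\<^bsub>E\<^esub> x = (inverse (z * ?k * ?k), \<one>\<^bsub>A\<^esub>)"
        by (rule E.comm_inv_char)
          (use z nz in \<open>auto simp: E_def cocycle_extension_def field_simps\<close>)
      then show ?thesis using z nz by (simp add: K_def)
    qed
  qed
  have snd_pow: "snd (x [^]\<^bsub>E\<^esub> i) = snd x [^]\<^bsub>A\<^esub> i" if "x \<in> carrier E" for x and i :: nat
  proof (induction i)
    case 0
    show ?case by (simp add: E_def cocycle_extension_def)
  next
    case (Suc i)
    have "snd (y \<otimes>\<^bsub>E\<^esub> z) = snd y \<otimes>\<^bsub>A\<^esub> snd z" for y z
      by (simp add: E_def cocycle_extension_def split_beta)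
    then show ?case using Suc by simp
  qed
  \<comment> \<open>The order of \<open>A\<close> annihilates the second component, which leaves an
    element of \<open>K\<close>.\<close>
  have torsion: "x [^]\<^bsub>E\<^esub> Coset.order A \<in> K" if x: "x \<in> carrier E" for x
  proof -
    have "x [^]\<^bsub>E\<^esub> Coset.order A \<in> carrier E" using x by simp
    moreover have "snd (x [^]\<^bsub>E\<^esub> Coset.order A) = \<one>\<^bsub>A\<^esub>"
    proof -
      have "snd x \<in> carrier A" using x by (auto simp: E_def cocycle_extension_def)
      then show ?thesis using x A.pow_order_eq_1 by (simp add: snd_pow)
    qed
    ultimately show ?thesis
      by (auto simp: K_def E_def cocycle_extension_def mem_Times_iff)
  qed
  have ord: "Coset.order A > 0"
    using fin A.order_gt_0_iff_finite by simp
  have "\<exists>H \<chi>. subgroup H E \<and> K \<subseteq> H \<and> Pair 1 ` S \<subseteq> H \<and> (\<forall>h \<in> H. \<chi> h \<noteq> (0::'k)) \<and>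
      (\<forall>h \<in> H. \<forall>h' \<in> H. \<chi> (h \<otimes>\<^bsub>E\<^esub> h') = \<chi> h * \<chi> h') \<and> (\<forall>h \<in> K. \<chi> h = \<chi>0 h)"
    if "finite S" "S \<subseteq> carrier A" for S
    using that
  proof (induction S)
    case empty
    show ?case
      by (rule exI[of _ K], rule exI[of _ \<chi>0])
        (use K nz in \<open>auto simp: K_def \<chi>0_def E_def cocycle_extension_def\<close>)
  next
    case (insert a S)
    then obtain H \<chi> where H: "subgroup H E" "K \<subseteq> H" "Pair 1 ` S \<subseteq> H"
      and \<chi>: "\<And>h. h \<in> H \<Longrightarrow> \<chi> h \<noteq> (0::'k)"
        "\<And>h h'. h \<in> H \<Longrightarrow> h' \<in> H \<Longrightarrow> \<chi> (h \<otimes>\<^bsub>E\<^esub> h') = \<chi> h * \<chi> h'" "\<And>h. h \<in> K \<Longrightarrow> \<chi> h = \<chi>0 h"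
      by (metis insert_subset)
    have a: "(1, a) \<in> carrier E"
      using insert.prems by (simp add: E_def cocycle_extension_def)
    obtain H' \<chi>' where "subgroup H' E" "H \<subseteq> H'" "(1, a) \<in> H'"
      "\<And>h. h \<in> H' \<Longrightarrow> \<chi>' h \<noteq> (0::'k)"
      "\<And>h h'. h \<in> H' \<Longrightarrow> h' \<in> H' \<Longrightarrow> \<chi>' (h \<otimes>\<^bsub>E\<^esub> h') = \<chi>' h * \<chi>' h'"
      "\<And>h. h \<in> H \<Longrightarrow> \<chi>' h = \<chi> h"
      using E.extend_character[OF H(1) a ord _ \<chi>(1,2)] torsion[OF a] H(2) by blast
    then show ?case
      using H \<chi>(3) by (intro exI[of _ H'] exI[of _ \<chi>']) (auto simp: subset_iff)
  qed
  from this[OF fin order_refl] obtain H \<chi> where H: "subgroup H E" "K \<subseteq> H" "Pair 1 ` carrier A \<subseteq> H"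
    and \<chi>: "\<And>h. h \<in> H \<Longrightarrow> \<chi> h \<noteq> (0::'k)"
      "\<And>h h'. h \<in> H \<Longrightarrow> h' \<in> H \<Longrightarrow> \<chi> (h \<otimes>\<^bsub>E\<^esub> h') = \<chi> h * \<chi> h'" "\<And>h. h \<in> K \<Longrightarrow> \<chi> h = \<chi>0 h"
    by blast
  show thesis
  proof
    fix a b assume ab: "a \<in> carrier A" "b \<in> carrier A"
    show "\<chi> (1, a) \<noteq> 0"
      using H(3) \<chi>(1) ab by blast
    \<comment> \<open>The product of \<open>(1, a)\<close> and \<open>(1, b)\<close> has first entry
      \<open>\<kappa> a b\<close>. Splitting off \<open>?s\<close> moves this scalar into
      \<open>K\<close>; its denominator cancels the factor
      \<open>\<kappa> 1 (a b) = \<kappa> 1 1\<close> that multiplication by \<open>?s\<close>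
      introduces.\<close>
    let ?s = "(\<kappa> a b * inverse (\<kappa> \<one>\<^bsub>A\<^esub> \<one>\<^bsub>A\<^esub>), \<one>\<^bsub>A\<^esub>)"
    have s: "?s \<in> K" using ab nz by (simp add: K_def)
    have "\<chi> (1, a) * \<chi> (1, b) = \<chi> ((1, a) \<otimes>\<^bsub>E\<^esub> (1, b))"
      using \<chi>(2) H(3) ab by (simp add: image_subset_iff)
    also have "(1, a) \<otimes>\<^bsub>E\<^esub> (1, b) = ?s \<otimes>\<^bsub>E\<^esub> (1, a \<otimes>\<^bsub>A\<^esub> b)"
      using ab nz one_left[of "a \<otimes>\<^bsub>A\<^esub> b"] by (simp add: E_def cocycle_extension_def)
    also have "\<chi> \<dots> = \<chi> ?s * \<chi> (1, a \<otimes>\<^bsub>A\<^esub> b)"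
      using \<chi>(2) H s ab by (simp add: image_subset_iff subset_iff)
    also have "\<chi> ?s = \<kappa> a b"
      using \<chi>(3)[OF s] nz by (simp add: \<chi>0_def)
    finally show "\<chi> (1, a) * \<chi> (1, b) = \<kappa> a b * \<chi> (1, a \<otimes>\<^bsub>A\<^esub> b)" .
  qed
qed


section \<open>Strict isomorphisms of bimodule categories\<close>

text \<open>
  Composition, sum and scaling of arrows are preserved without a typing condition; this holds for
  arrows given by matrices and makes the coherence axioms transfer by mere rewriting.
\<close>

locale strict_bimodule_iso =
  fixes C :: "('c, 'cm, 'k::field) moncat"
    and D :: "('d, 'dm, 'k) moncat"
    and M :: "('o, 'm, 'k, 'c, 'cm, 'd, 'dm) bimod"
    and N :: "('p, 'n, 'k, 'c, 'cm, 'd, 'dm) bimod"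
    and FO :: "'o \<Rightarrow> 'p" and FA :: "'m \<Rightarrow> 'n"
  assumes dom_cod: "h \<in> Arr M \<Longrightarrow> Dom M h \<in> Ob M \<and> Cod M h \<in> Ob M"
    and ob_bij: "bij_betw FO (Ob M) (Ob N)"
    and hom_bij: "\<lbrakk>m \<in> Ob M; n \<in> Ob M\<rbrakk> \<Longrightarrow> bij_betw FA (Hom M m n) (Hom N (FO m) (FO n))"
    and id: "m \<in> Ob M \<Longrightarrow> FA (Id M m) = Id N (FO m)"
    and comp: "FA (g \<cdot>\<^bsub>M\<^esub> h) = FA g \<cdot>\<^bsub>N\<^esub> FA h"
    and plus: "FA (Plus M g h) = Plus N (FA g) (FA h)"
    and scale: "FA (Scale M a h) = Scale N a (FA h)"
    and lact_ob: "\<lbrakk>X \<in> Ob C; m \<in> Ob M\<rbrakk> \<Longrightarrow> FO (X \<triangleright>\<^bsub>M\<^esub> m) = X \<triangleright>\<^bsub>N\<^esub> FO m"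
    and lact_arr: "\<lbrakk>f \<in> Arr C; h \<in> Arr M\<rbrakk> \<Longrightarrow> FA (LActA M f h) = LActA N f (FA h)"
    and ract_ob: "\<lbrakk>m \<in> Ob M; P \<in> Ob D\<rbrakk> \<Longrightarrow> FO (m \<triangleleft>\<^bsub>M\<^esub> P) = FO m \<triangleleft>\<^bsub>N\<^esub> P"
    and ract_arr: "\<lbrakk>h \<in> Arr M; v \<in> Arr D\<rbrakk> \<Longrightarrow> FA (RActA M h v) = RActA N (FA h) v"
    and lassoc: "\<lbrakk>X \<in> Ob C; Y \<in> Ob C; m \<in> Ob M\<rbrakk> \<Longrightarrow> FA (LAssoc M X Y m) = LAssoc N X Y (FO m)"
    and lunitor: "m \<in> Ob M \<Longrightarrow> FA (LUnitor M m) = LUnitor N (FO m)"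
    and rassoc: "\<lbrakk>m \<in> Ob M; P \<in> Ob D; Q \<in> Ob D\<rbrakk> \<Longrightarrow> FA (RAssoc M m P Q) = RAssoc N (FO m) P Q"
    and runitor: "m \<in> Ob M \<Longrightarrow> FA (RUnitor M m) = RUnitor N (FO m)"
    and massoc: "\<lbrakk>X \<in> Ob C; m \<in> Ob M; P \<in> Ob D\<rbrakk> \<Longrightarrow> FA (MAssoc M X m P) = MAssoc N X (FO m) P"
begin

lemma ob: "m \<in> Ob M \<Longrightarrow> FO m \<in> Ob N"
  using ob_bij by (rule bij_betwE[THEN bspec])

lemma arr: "h \<in> Hom M m n \<Longrightarrow> FA h \<in> Hom N (FO m) (FO n)"
  using hom_bij[of m n] dom_cod[of h] by (auto simp: Hom_def bij_betw_def)

lemma iso: "iso_arr M m n h \<Longrightarrow> iso_arr N (FO m) (FO n) (FA h)"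
proof -
  assume "iso_arr M m n h"
  then obtain g where h: "h \<in> Hom M m n" and g: "g \<in> Hom M n m"
    and inv: "g \<cdot>\<^bsub>M\<^esub> h = Id M m" "h \<cdot>\<^bsub>M\<^esub> g = Id M n"
    unfolding iso_arr_def by blast
  have "m \<in> Ob M" "n \<in> Ob M"
    using h dom_cod[of h] by (auto simp: Hom_def)
  then have "FA g \<cdot>\<^bsub>N\<^esub> FA h = Id N (FO m)" "FA h \<cdot>\<^bsub>N\<^esub> FA g = Id N (FO n)"
    using inv id comp by metis+
  then show ?thesis
    using arr[OF h] arr[OF g] unfolding iso_arr_def by blast
qed

lemma linear_functor_compose:
  assumes G: "linear_functor K M GO GA"
  shows "linear_functor K N (FO \<circ> GO) (FA \<circ> GA)"
  using G ob arr unfolding linear_functor_def by (auto simp: id comp plus scale)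

text \<open>Each axiom of the composite is the image under \<open>FA\<close> of the same axiom for
  the given functor. The hypotheses on identities are there because the coherence axioms contain
  actions of \<open>Id C X\<close> and \<open>Id D P\<close>, and actions are preserved only for
  arrows of \<open>C\<close> and \<open>D\<close>.\<close>

lemma bimodule_functor_compose:
  assumes Cid: "\<And>X. X \<in> Ob C \<Longrightarrow> Id C X \<in> Arr C"
    and Did: "\<And>P. P \<in> Ob D \<Longrightarrow> Id D P \<in> Arr D"
    and G: "bimodule_functor C D K M GO GA SL SR"
  shows "bimodule_functor C D K N (FO \<circ> GO) (FA \<circ> GA) (\<lambda>X m. FA (SL X m)) (\<lambda>m P. FA (SR m P))"
proof -
  interpret G: bimodule_functor C D K M GO GA SL SR by (rule G)
  have GO: "GO m \<in> Ob M" if "m \<in> Ob K" for m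
    using G.linear that by (simp add: linear_functor_def)
  have GA: "GA h \<in> Arr M" if "h \<in> Arr K" for h
    using G.linear that by (auto simp: linear_functor_def Hom_def)
  have SL: "SL X m \<in> Arr M" if "X \<in> Ob C" "m \<in> Ob K" for X m
    using G.sl_iso[OF that] by (simp add: iso_arr_def Hom_def)
  have SR: "SR m P \<in> Arr M" if "m \<in> Ob K" "P \<in> Ob D" for m P
    using G.sr_iso[OF that] by (simp add: iso_arr_def Hom_def)
  show ?thesis
  proof (unfold_locales, goal_cases)
    case 1
    show ?case using G.linear by (rule linear_functor_compose)
  next
    case (2 X m)
    then show ?case using iso[OF G.sl_iso[OF 2]] lact_ob GO by simp
  next
    case (3 f h)
    then show ?case using arg_cong[OF G.sl_nat[OF 3], of FA] by (simp add: comp lact_arr GA)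
  next
    case (4 m P)
    then show ?case using iso[OF G.sr_iso[OF 4]] ract_ob GO by simp
  next
    case (5 h v)
    then show ?case using arg_cong[OF G.sr_nat[OF 5], of FA] by (simp add: comp ract_arr GA)
  next
    case (6 X Y m)
    then show ?case
      using arg_cong[OF G.left_assoc[OF 6], of FA] by (simp add: comp lact_arr lassoc GO SL Cid)
  next
    case (7 m)
    then show ?case using arg_cong[OF G.left_unit[OF 7], of FA] by (simp add: comp lunitor GO)
  next
    case (8 m P Q)
    then show ?case
      using arg_cong[OF G.right_assoc[OF 8], of FA] by (simp add: comp ract_arr rassoc GO SR Did)
  next
    case (9 m)
    then show ?case using arg_cong[OF G.right_unit[OF 9], of FA] by (simp add: comp runitor GO)
  next
    case (10 X m P)
    then show ?case
      using arg_cong[OF G.middle[OF 10], of FA]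
      by (simp add: comp lact_arr ract_arr massoc GO SL SR Cid Did)
  qed
qed

lemma equivalence_functor_compose:
  assumes G: "equivalence_functor K M GO GA"
  shows "equivalence_functor K N (FO \<circ> GO) (FA \<circ> GA)"
proof -
  have lin: "linear_functor K M GO GA"
    and bij: "\<And>m n. \<lbrakk>m \<in> Ob K; n \<in> Ob K\<rbrakk> \<Longrightarrow> bij_betw GA (Hom K m n) (Hom M (GO m) (GO n))"
    and surj: "\<And>p. p \<in> Ob M \<Longrightarrow> \<exists>m \<in> Ob K. \<exists>f. iso_arr M (GO m) p f"
    using G unfolding equivalence_functor_def by blast+
  have GO: "GO m \<in> Ob M" if "m \<in> Ob K" for m
    using lin that by (simp add: linear_functor_def)
  have "linear_functor K N (FO \<circ> GO) (FA \<circ> GA)"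
    using lin by (rule linear_functor_compose)
  moreover have "bij_betw (FA \<circ> GA) (Hom K m n) (Hom N ((FO \<circ> GO) m) ((FO \<circ> GO) n))"
    if "m \<in> Ob K" "n \<in> Ob K" for m n
    using bij_betw_trans[OF bij[OF that] hom_bij] GO that by simp
  moreover have "\<exists>m \<in> Ob K. \<exists>f. iso_arr N ((FO \<circ> GO) m) q f" if q: "q \<in> Ob N" for q
  proof -
    obtain p where "p \<in> Ob M" "q = FO p"
      using q ob_bij by (auto simp: bij_betw_def)
    then show ?thesis using surj iso by fastforce
  qed
  ultimately show ?thesis unfolding equivalence_functor_def by blast
qed

text \<open>Applied to strict isomorphisms in both directions, this replaces transitivity and
  symmetry of equivalence.\<close>

lemma bimodule_equivalent_compose:
  assumes "\<And>X. X \<in> Ob C \<Longrightarrow> Id C X \<in> Arr C" "\<And>P. P \<in> Ob D \<Longrightarrow> Id D P \<in> Arr D"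
    and "bimodule_equivalent C D K M"
  shows "bimodule_equivalent C D K N"
  using assms bimodule_functor_compose equivalence_functor_compose
  unfolding bimodule_equivalent_def by blast

end


section \<open>Kronecker products and graded vector spaces\<close>

lemma dim_kron [simp]:
  "dim_row (kron A B) = dim_row A * dim_row B" "dim_col (kron A B) = dim_col A * dim_col B"
  by (simp_all add: kron_def)

lemma index_kron:
  assumes "i < dim_row A * dim_row B" "j < dim_col A * dim_col B"
  shows "kron A B $$ (i, j) =
    A $$ (i div dim_row B, j div dim_col B) * B $$ (i mod dim_row B, j mod dim_col B)"
  using assms by (simp add: kron_def)

lemma div_mod_less_mult:
  assumes "i < a * b"
  shows "i div b < (a::nat)" "i mod b < b"
proof -
  have "b > 0" using assms by (cases b) auto
  then show "i div b < a" "i mod b < b"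
    using assms by (auto simp: less_mult_imp_div_less)
qed

lemma kron_one_one: "kron (1\<^sub>m a) (1\<^sub>m b) = 1\<^sub>m (a * b)"
proof (rule eq_matI)
  fix i j assume "i < dim_row (1\<^sub>m (a * b))" "j < dim_col (1\<^sub>m (a * b))"
  then have ij: "i < a * b" "j < a * b" by auto
  have "i div b = j div b \<and> i mod b = j mod b \<longleftrightarrow> i = j"
    by (metis div_mult_mod_eq)
  then show "kron (1\<^sub>m a) (1\<^sub>m b) $$ (i, j) = 1\<^sub>m (a * b) $$ (i, j)"
    using ij div_mod_less_mult[OF ij(1)] div_mod_less_mult[OF ij(2)] by (auto simp: index_kron)
qed auto

lemma kron_smult_right: "kron A (c \<cdot>\<^sub>m B) = c \<cdot>\<^sub>m kron A B"
  by (rule eq_matI) (auto simp: index_kron div_mod_less_mult)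

lemma kron_smult_left: "kron (c \<cdot>\<^sub>m A) B = c \<cdot>\<^sub>m kron A B"
  by (rule eq_matI) (auto simp: index_kron div_mod_less_mult)

lemma kron_mult:
  assumes "dim_col A = dim_row A'" "dim_col B = dim_row B'"
  shows "kron A B * kron A' B' = kron (A * A') (B * B')"
proof (rule eq_matI)
  fix i j assume "i < dim_row (kron (A * A') (B * B'))" "j < dim_col (kron (A * A') (B * B'))"
  then have i: "i < dim_row A * dim_row B" and j: "j < dim_col A' * dim_col B'" by auto
  let ?i = "i div dim_row B" and ?i' = "i mod dim_row B"
  let ?j = "j div dim_col B'" and ?j' = "j mod dim_col B'"
  let ?n = "dim_row A'" and ?m = "dim_row B'"
  note ii = div_mod_less_mult[OF i] and jj = div_mod_less_mult[OF j]
  have "(kron A B * kron A' B') $$ (i, j) =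
      (\<Sum>k < ?n * ?m. kron A B $$ (i, k) * kron A' B' $$ (k, j))"
    using i j assms by (simp add: scalar_prod_def atLeast0LessThan)
  also have "\<dots> = (\<Sum>k < ?n * ?m. (\<lambda>(p, q). (A $$ (?i, p) * A' $$ (p, ?j)) * (B $$ (?i', q) * B' $$ (q, ?j')))
      (k div ?m, k mod ?m))"
    by (rule sum.cong) (use i j assms in \<open>auto simp: index_kron mult_ac\<close>)
  also have "\<dots> = (\<Sum>(p, q) \<in> {..<?n} \<times> {..<?m}.
      (A $$ (?i, p) * A' $$ (p, ?j)) * (B $$ (?i', q) * B' $$ (q, ?j')))"
  \<comment> \<open>Quotient and remainder by \<open>?m\<close> turn the single summation index into
    a pair, after which the double sum factors.\<close>
  proof (rule sum.reindex_bij_witness[where i = "\<lambda>(p, q). p * ?m + q" and j = "\<lambda>k. (k div ?m, k mod ?m)"])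
    fix x assume x: "x \<in> {..<?n} \<times> {..<?m}"
    then obtain p q where pq: "x = (p, q)" "p < ?n" "q < ?m" by auto
    have "p * ?m + q < Suc p * ?m" using pq by simp
    also have "\<dots> \<le> ?n * ?m" using pq by (intro mult_le_mono1) simp
    finally show "(case x of (p, q) \<Rightarrow> p * ?m + q) \<in> {..<?n * ?m}" using pq by simp
    show "((case x of (p, q) \<Rightarrow> p * ?m + q) div ?m, (case x of (p, q) \<Rightarrow> p * ?m + q) mod ?m) = x"
      using pq by simp
  qed (auto dest: div_mod_less_mult)
  also have "\<dots> = (\<Sum>p < ?n. A $$ (?i, p) * A' $$ (p, ?j)) * (\<Sum>q < ?m. B $$ (?i', q) * B' $$ (q, ?j'))"
    by (simp add: sum_product sum.cartesian_product)
  also have "\<dots> = kron (A * A') (B * B') $$ (i, j)"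
    using i j ii jj assms by (simp add: index_kron scalar_prod_def atLeast0LessThan)
  finally show "(kron A B * kron A' B') $$ (i, j) = kron (A * A') (B * B') $$ (i, j)" .
qed auto

lemma length_convolve [simp]: "length (convolve f X Y) = length X * length Y"
  by (induction X) (simp_all add: convolve_def)

text \<open>The same quotient and remainder indexing as in \<open>kron\<close>, so that rows and
  columns of a Kronecker product match the degrees of the tensor basis.\<close>

lemma nth_convolve:
  assumes "i < length X * length Y"
  shows "convolve f X Y ! i = f (X ! (i div length Y)) (Y ! (i mod length Y))"
  using assms
proof (induction X arbitrary: i)
  case (Cons x X)
  have conv: "convolve f (x # X) Y = map (f x) Y @ convolve f X Y"
    by (simp add: convolve_def)
  show ?case
  proof (cases "i < length Y")
    case True
    then show ?thesis by (simp add: conv nth_append)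
  next
    case False
    have pos: "length Y > 0" using Cons.prems by (cases Y) auto
    have "i - length Y < length X * length Y" using Cons.prems False by auto
    moreover have "i div length Y = Suc ((i - length Y) div length Y)"
      "i mod length Y = (i - length Y) mod length Y"
      using False pos by (simp_all add: le_div_geq le_mod_geq)
    ultimately show ?thesis using Cons.IH False by (simp add: conv nth_append)
  qed
qed simp

lemma set_convolve: "set (convolve f X Y) = (\<Union>x \<in> set X. f x ` set Y)"
  by (auto simp: convolve_def)

lemma map_convolve: "map h (convolve f X Y) = convolve (\<lambda>x y. h (f x y)) X Y"
  by (simp add: convolve_def map_concat comp_def)

text \<open>A nonzero entry of the product forces both factors to be nonzero, hence both degree
  relations. The map \<open>f\<close> and the three groups are kept arbitrary to cover the left and
  the right action alike.\<close>

lemma homogeneous_kron: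
  assumes P: "homogeneous G d V V' P" and Q: "homogeneous H e W W' Q"
    and mult: "\<And>v w. v \<in> set V \<Longrightarrow> w \<in> set W \<Longrightarrow> f (v \<otimes>\<^bsub>G\<^esub> d) (w \<otimes>\<^bsub>H\<^esub> e) = f v w \<otimes>\<^bsub>K\<^esub> c"
  shows "homogeneous K c (convolve f V W) (convolve f V' W') (kron P Q)"
  unfolding homogeneous_def
proof (intro conjI allI impI)
  have dim: "dim_row P = length V'" "dim_col P = length V" "dim_row Q = length W'" "dim_col Q = length W"
    using P Q by (auto simp: homogeneous_def)
  then show "kron P Q \<in> carrier_mat (length (convolve f V' W')) (length (convolve f V W))"
    by auto
  fix i j assume "i < length (convolve f V' W')" "j < length (convolve f V W)"
    and nz: "kron P Q $$ (i, j) \<noteq> 0"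
  then have i: "i < length V' * length W'" and j: "j < length V * length W" by auto
  note ii = div_mod_less_mult[OF i] and jj = div_mod_less_mult[OF j]
  have "P $$ (i div length W', j div length W) \<noteq> 0" "Q $$ (i mod length W', j mod length W) \<noteq> 0"
    using nz i j dim by (auto simp: index_kron)
  then have "V' ! (i div length W') = V ! (j div length W) \<otimes>\<^bsub>G\<^esub> d"
    "W' ! (i mod length W') = W ! (j mod length W) \<otimes>\<^bsub>H\<^esub> e"
    using P Q ii jj by (auto simp: homogeneous_def)
  then show "convolve f V' W' ! i = convolve f V W ! j \<otimes>\<^bsub>K\<^esub> c"
    using i j ii jj mult by (simp add: nth_convolve)
qed

lemma homogeneous_one:
  assumes "monoid G" "set V \<subseteq> carrier G"
  shows "homogeneous G \<one>\<^bsub>G\<^esub> V V (1\<^sub>m (length V))"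
proof -
  interpret monoid G by fact
  have "V ! i \<in> carrier G" if "i < length V" for i
    using assms(2) that by auto
  then show ?thesis
    unfolding homogeneous_def by (auto split: if_splits)
qed


section \<open>The bimodule category of a correspondence\<close>

lemma Vect_simps [simp]:
  "Ob (Vect G) = lists (carrier G)"
  "Dom (Vect G) (X, P, Y) = X" "Cod (Vect G) (X, P, Y) = Y"
  "Id (Vect G) X = (X, 1\<^sub>m (length X), X)"
  "TenO (Vect G) X Y = convolve (monoid.mult G) X Y"
  "Unit (Vect G) = [\<one>\<^bsub>G\<^esub>]"
  by (simp_all add: Vect_def Let_def)

lemma Arr_Vect: "(X, P, Y) \<in> Arr (Vect G) \<longleftrightarrow>
    X \<in> lists (carrier G) \<and> Y \<in> lists (carrier G) \<and> homogeneous G \<one>\<^bsub>G\<^esub> X Y P"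
  by (simp add: Vect_def Let_def)

lemma Id_Vect_in_Arr: "monoid G \<Longrightarrow> X \<in> lists (carrier G) \<Longrightarrow> (X, 1\<^sub>m (length X), X) \<in> Arr (Vect G)"
  unfolding Arr_Vect by (auto intro: homogeneous_one)

lemma Sum3_simps [simp]:
  "Ob (Sum3 G H K) = twisted_modules (G \<times>\<times> H) K"
  "Dom (Sum3 G H K) (m, F, n) = m" "Cod (Sum3 G H K) (m, F, n) = n"
  "Id (Sum3 G H K) m = (m, 1\<^sub>m (length (fst m)), m)"
  "Comp (Sum3 G H K) (m', F', p) (m, F, n) = (m, F' * F, p)"
  "Plus (Sum3 G H K) (m, F, n) (m', F', p) = (m, F + F', n)"
  "Scale (Sum3 G H K) a (m, F, n) = (m, a \<cdot>\<^sub>m F, n)"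
  "LActA (Sum3 G H K) (X, P, X') (m, F, n) =
     (LActO (Sum3 G H K) X m, kron P F, LActO (Sum3 G H K) X' n)"
  "RActA (Sum3 G H K) (m, F, n) (Y, P, Y') =
     (RActO (Sum3 G H K) m Y, kron F P, RActO (Sum3 G H K) n Y')"
  "LUnitor (Sum3 G H K) m = (LActO (Sum3 G H K) [\<one>\<^bsub>G\<^esub>] m, 1\<^sub>m (length (fst m)), m)"
  "RUnitor (Sum3 G H K) m = (RActO (Sum3 G H K) m [\<one>\<^bsub>H\<^esub>], 1\<^sub>m (length (fst m)), m)"
  by (simp_all add: Sum3_def Let_def split_beta)

lemma LActO_Sum3:
  "LActO (Sum3 G H K) X m =
     (convolve (\<lambda>x (v, w). (x \<otimes>\<^bsub>G\<^esub> v, w)) X (fst m), \<lambda>c\<in>fst K. kron (1\<^sub>m (length X)) (snd m c))"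
  by (simp add: Sum3_def Let_def split_beta)

lemma RActO_Sum3:
  "RActO (Sum3 G H K) m Y =
     (convolve (\<lambda>(v, w) y. (v, w \<otimes>\<^bsub>H\<^esub> inv\<^bsub>H\<^esub> y)) (fst m) Y,
      \<lambda>c\<in>fst K. kron (snd m c) (1\<^sub>m (length Y)))"
  by (simp add: Sum3_def Let_def split_beta)

text \<open>Structure arrows are identity matrices, so the length of a module is all that has to be
  computed; the actions themselves stay folded.\<close>

lemma length_fst_LActO_Sum3 [simp]: "length (fst (LActO (Sum3 G H K) X m)) = length X * length (fst m)"
  by (simp add: LActO_Sum3)

lemma length_fst_RActO_Sum3 [simp]: "length (fst (RActO (Sum3 G H K) m Y)) = length (fst m) * length Y"
  by (simp add: RActO_Sum3)

lemma assoc_Sum3 [simp]: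
  "LAssoc (Sum3 G H K) X Y m =
     (LActO (Sum3 G H K) (convolve (monoid.mult G) X Y) m, 1\<^sub>m (length X * length Y * length (fst m)),
      LActO (Sum3 G H K) X (LActO (Sum3 G H K) Y m))"
  "RAssoc (Sum3 G H K) m X' Y' =
     (RActO (Sum3 G H K) (RActO (Sum3 G H K) m X') Y', 1\<^sub>m (length (fst m) * length X' * length Y'),
      RActO (Sum3 G H K) m (convolve (monoid.mult H) X' Y'))"
  "MAssoc (Sum3 G H K) X m Y' =
     (RActO (Sum3 G H K) (LActO (Sum3 G H K) X m) Y', 1\<^sub>m (length X * length (fst m) * length Y'),
      LActO (Sum3 G H K) X (RActO (Sum3 G H K) m Y'))"
  by (simp_all add: Sum3_def Let_def split_beta)

lemma Arr_Sum3: "(m, F, n) \<in> Arr (Sum3 G H K) \<longleftrightarrow>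
    m \<in> twisted_modules (G \<times>\<times> H) K \<and> n \<in> twisted_modules (G \<times>\<times> H) K \<and>
    homogeneous (G \<times>\<times> H) \<one>\<^bsub>G \<times>\<times> H\<^esub> (fst m) (fst n) F \<and> (\<forall>c \<in> fst K. F * snd m c = snd n c * F)"
  by (simp add: Sum3_def Let_def)

lemma Hom_Sum3: "f \<in> Hom (Sum3 G H K) m n \<longleftrightarrow> (\<exists>F. f = (m, F, n) \<and> (m, F, n) \<in> Arr (Sum3 G H K))"
  unfolding Hom_def by (cases f) auto

lemma twisted_modules_iff: "(V, \<rho>) \<in> twisted_modules A (C, \<kappa>) \<longleftrightarrow>
    V \<in> lists (carrier A) \<and> \<rho> \<in> extensional C \<and> (\<forall>c \<in> C. homogeneous A c V V (\<rho> c)) \<and>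
    \<rho> \<one>\<^bsub>A\<^esub> = \<kappa> \<one>\<^bsub>A\<^esub> \<one>\<^bsub>A\<^esub> \<cdot>\<^sub>m 1\<^sub>m (length V) \<and>
    (\<forall>c \<in> C. \<forall>d \<in> C. \<rho> d * \<rho> c = \<kappa> c d \<cdot>\<^sub>m \<rho> (c \<otimes>\<^bsub>A\<^esub> d))"
  by (simp add: twisted_modules_def)

section \<open>Closure of twisted modules under both actions, and reflexivity of equivalence\<close>

locale Sum3_groups = G: group G + H: comm_group H
  for G :: "'g monoid" and H :: "'h monoid" +
  fixes C :: "('g \<times> 'h) set" and \<kappa> :: "'g \<times> 'h \<Rightarrow> 'g \<times> 'h \<Rightarrow> 'k::field"
  assumes subgroup: "subgroup C (G \<times>\<times> H)"
begin

abbreviation "S \<equiv> Sum3 G H (C, \<kappa>)"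

lemma C_closed:
  "c \<in> C \<Longrightarrow> c \<in> carrier G \<times> carrier H" "\<one>\<^bsub>G \<times>\<times> H\<^esub> \<in> C"
  "c \<in> C \<Longrightarrow> d \<in> C \<Longrightarrow> c \<otimes>\<^bsub>G \<times>\<times> H\<^esub> d \<in> C"
  using subgroup.mem_carrier[OF subgroup] subgroup.one_closed[OF subgroup]
    subgroup.m_closed[OF subgroup] by auto

lemma LActO_closed:
  assumes X: "X \<in> lists (carrier G)" and m: "m \<in> Ob S"
  shows "LActO S X m \<in> Ob S"
proof -
  obtain V \<rho> where m_eq: "m = (V, \<rho>)" by (cases m)
  have m': "V \<in> lists (carrier G \<times> carrier H)" "\<And>c. c \<in> C \<Longrightarrow> homogeneous (G \<times>\<times> H) c V V (\<rho> c)"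
    "\<rho> \<one>\<^bsub>G \<times>\<times> H\<^esub> = \<kappa> \<one>\<^bsub>G \<times>\<times> H\<^esub> \<one>\<^bsub>G \<times>\<times> H\<^esub> \<cdot>\<^sub>m 1\<^sub>m (length V)"
    "\<And>c d. c \<in> C \<Longrightarrow> d \<in> C \<Longrightarrow> \<rho> d * \<rho> c = \<kappa> c d \<cdot>\<^sub>m \<rho> (c \<otimes>\<^bsub>G \<times>\<times> H\<^esub> d)"
    using m by (auto simp: m_eq twisted_modules_iff)
  have dim: "dim_row (\<rho> c) = length V" "dim_col (\<rho> c) = length V" if "c \<in> C" for c
    using m'(2)[OF that] by (auto simp: homogeneous_def)
  let ?f = "\<lambda>x (v, w). (x \<otimes>\<^bsub>G\<^esub> v, w)"
  have "homogeneous (G \<times>\<times> H) c (convolve ?f X V) (convolve ?f X V) (kron (1\<^sub>m (length X)) (\<rho> c))"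
    if "c \<in> C" for c
  proof (rule homogeneous_kron[OF homogeneous_one m'(2)[OF that]])
    fix x p assume "x \<in> set X" "p \<in> set V"
    then have "x \<in> carrier G" "fst p \<in> carrier G"
      using X m'(1) by auto
    then show "?f (x \<otimes>\<^bsub>G\<^esub> \<one>\<^bsub>G\<^esub>) (p \<otimes>\<^bsub>G \<times>\<times> H\<^esub> c) = ?f x p \<otimes>\<^bsub>G \<times>\<times> H\<^esub> c"
      using C_closed(1)[OF that] by (auto simp: split_beta mult_DirProd' G.m_assoc)
  qed (use X in \<open>auto simp: G.is_monoid\<close>)
  moreover have "set (convolve ?f X V) \<subseteq> carrier G \<times> carrier H"
    using X m'(1) by (auto simp: set_convolve)
  ultimately show ?thesis
    using m' C_closed dim
    by (auto simp: m_eq LActO_Sum3 twisted_modules_iff kron_smult_right kron_one_one kron_mult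
        simp del: one_DirProd)
qed

text \<open>Commutativity of \<open>H\<close> enters here: both the right action and the module
  structure multiply the second degree on the right. For the left action they multiply the first
  degree on opposite sides, and associativity is enough.\<close>

lemma RActO_closed:
  assumes Y: "Y \<in> lists (carrier H)" and m: "m \<in> Ob S"
  shows "RActO S m Y \<in> Ob S"
proof -
  obtain V \<rho> where m_eq: "m = (V, \<rho>)" by (cases m)
  have m': "V \<in> lists (carrier G \<times> carrier H)" "\<And>c. c \<in> C \<Longrightarrow> homogeneous (G \<times>\<times> H) c V V (\<rho> c)"
    "\<rho> \<one>\<^bsub>G \<times>\<times> H\<^esub> = \<kappa> \<one>\<^bsub>G \<times>\<times> H\<^esub> \<one>\<^bsub>G \<times>\<times> H\<^esub> \<cdot>\<^sub>m 1\<^sub>m (length V)"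
    "\<And>c d. c \<in> C \<Longrightarrow> d \<in> C \<Longrightarrow> \<rho> d * \<rho> c = \<kappa> c d \<cdot>\<^sub>m \<rho> (c \<otimes>\<^bsub>G \<times>\<times> H\<^esub> d)"
    using m by (auto simp: m_eq twisted_modules_iff)
  have dim: "dim_row (\<rho> c) = length V" "dim_col (\<rho> c) = length V" if "c \<in> C" for c
    using m'(2)[OF that] by (auto simp: homogeneous_def)
  let ?f = "\<lambda>(v, w) y. (v, w \<otimes>\<^bsub>H\<^esub> inv\<^bsub>H\<^esub> y)"
  have "homogeneous (G \<times>\<times> H) c (convolve ?f V Y) (convolve ?f V Y) (kron (\<rho> c) (1\<^sub>m (length Y)))"
    if "c \<in> C" for c
  proof (rule homogeneous_kron[OF m'(2)[OF that] homogeneous_one])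
    fix y p assume "p \<in> set V" "y \<in> set Y"
    then have "y \<in> carrier H" "snd p \<in> carrier H"
      using Y m'(1) by auto
    then show "?f (p \<otimes>\<^bsub>G \<times>\<times> H\<^esub> c) (y \<otimes>\<^bsub>H\<^esub> \<one>\<^bsub>H\<^esub>) = ?f p y \<otimes>\<^bsub>G \<times>\<times> H\<^esub> c"
      using C_closed(1)[OF that] by (auto simp: split_beta mult_DirProd' H.m_ac)
  qed (use Y in \<open>auto simp: H.is_monoid\<close>)
  moreover have "set (convolve ?f V Y) \<subseteq> carrier G \<times> carrier H"
    using Y m'(1) by (auto simp: set_convolve)
  ultimately show ?thesis
    using m' C_closed dim
    by (auto simp: m_eq RActO_Sum3 twisted_modules_iff kron_smult_left kron_one_one kron_mult
        simp del: one_DirProd)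
qed

lemma Id_iso:
  assumes m: "m \<in> Ob S"
  shows "iso_arr S m m (Id S m)"
proof -
  obtain V \<rho> where m_eq: "m = (V, \<rho>)" by (cases m)
  have "homogeneous (G \<times>\<times> H) \<one>\<^bsub>G \<times>\<times> H\<^esub> V V (1\<^sub>m (length V))"
    using m by (intro homogeneous_one)
      (auto simp: m_eq twisted_modules_iff G.is_monoid H.is_monoid intro!: DirProd_monoid)
  moreover have "\<rho> c \<in> carrier_mat (length V) (length V)" if "c \<in> C" for c
    using m that by (simp add: m_eq twisted_modules_iff homogeneous_def)
  then have "1\<^sub>m (length V) * \<rho> c = \<rho> c * 1\<^sub>m (length V)" if "c \<in> C" for c
    using that by (metis left_mult_one_mat right_mult_one_mat)
  ultimately have "Id S m \<in> Hom S m m"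
    using m by (simp add: m_eq Hom_Sum3 Arr_Sum3 del: one_DirProd)
  then show ?thesis
    unfolding iso_arr_def by (auto intro!: bexI[of _ "Id S m"])
qed

text \<open>The starting point to which a strict isomorphism is applied. The constraints
  \<open>SL\<close> and \<open>SR\<close> are identities.\<close>

lemma equivalent_refl: "bimodule_equivalent (Vect G) (Vect H) S S"
  unfolding bimodule_equivalent_def
proof (intro exI conjI)
  have lin: "linear_functor S S (\<lambda>m. m) (\<lambda>h. h)"
    unfolding linear_functor_def by (auto simp: Hom_def)
  show "equivalence_functor S S (\<lambda>m. m) (\<lambda>h. h)"
    unfolding equivalence_functor_def bij_betw_def using lin Id_iso 
    by (simp del: Sum3_simps split_paired_Ex) blast
  \<comment> \<open>Naturality multiplies a Kronecker product by identities on both sides, so the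
    sizes of its factors must be known; homogeneity records them.\<close>
  have dimS: "F \<in> carrier_mat (length (fst n)) (length (fst m))" if "(m, F, n) \<in> Arr S" for m F n
    using that by (simp add: Arr_Sum3 homogeneous_def)
  have dimV: "P \<in> carrier_mat (length Y) (length X)" if "(X, P, Y) \<in> Arr (Vect K)"
    for K :: "'z monoid" and X P Y
    using that by (simp add: Arr_Vect homogeneous_def)
  show "bimodule_functor (Vect G) (Vect H) S S (\<lambda>m. m) (\<lambda>h. h)
      (\<lambda>X m. Id S (LActO S X m)) (\<lambda>m Y. Id S (RActO S m Y))"
  proof (unfold_locales, goal_cases)
    case 1
    show ?case by (rule lin)
  next
    case (2 X m)
    then show ?case using LActO_closed by (intro Id_iso) simp
  next
    case (3 f h)
    obtain X P Y m F n where eq: "f = (X, P, Y)" "h = (m, F, n)" by (cases f, cases h)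
    have "kron P F \<in> carrier_mat (length Y * length (fst n)) (length X * length (fst m))"
      using dimS dimV 3 unfolding eq by (metis carrier_matD carrier_matI dim_kron)
    then show ?case
      by (simp add: eq left_mult_one_mat[of _ _ "length X * length (fst m)"]
          right_mult_one_mat[of _ "length Y * length (fst n)"])
  next
    case (4 m Y)
    then show ?case using RActO_closed by (intro Id_iso) simp
  next
    case (5 h f)
    obtain X P Y m F n where eq: "f = (X, P, Y)" "h = (m, F, n)" by (cases f, cases h)
    have "kron F P \<in> carrier_mat (length (fst n) * length Y) (length (fst m) * length X)"
      using dimS dimV 5 unfolding eq by (metis carrier_matD carrier_matI dim_kron)
    then show ?case
      by (simp add: eq left_mult_one_mat[of _ _ "length (fst m) * length X"]
          right_mult_one_mat[of _ "length (fst n) * length Y"])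
  qed (simp_all add: kron_one_one mult.assoc)
qed

end


section \<open>Relabelling degrees and rescaling\<close>

lemma restrict_right_simps [simp]:
  "Ob (restrict_right h M) = Ob M" "Arr (restrict_right h M) = Arr M"
  "Dom (restrict_right h M) = Dom M" "Cod (restrict_right h M) = Cod M"
  "Id (restrict_right h M) = Id M" "Comp (restrict_right h M) = Comp M"
  "Plus (restrict_right h M) = Plus M" "Scale (restrict_right h M) = Scale M"
  "LActO (restrict_right h M) = LActO M" "LActA (restrict_right h M) = LActA M"
  "RActO (restrict_right h M) m Y = RActO M m (map h Y)"
  "RActA (restrict_right h M) F (Y, P, Y') = RActA M F (map h Y, P, map h Y')"
  "LAssoc (restrict_right h M) = LAssoc M" "LUnitor (restrict_right h M) = LUnitor M"
  "RAssoc (restrict_right h M) m Y Z = RAssoc M m (map h Y) (map h Z)"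
  "RUnitor (restrict_right h M) = RUnitor M"
  "MAssoc (restrict_right h M) X m Y = MAssoc M X m (map h Y)"
  by (simp_all add: restrict_right_def)

lemma Hom_restrict_right [simp]: "Hom (restrict_right h M) = Hom M"
  by (simp add: Hom_def fun_eq_iff)

text \<open>Gives an unrestricted category the shape that \<open>strict_iso_relabel\<close> expects
  on each side.\<close>

lemma restrict_right_id:
  fixes M :: "('o, 'm, 'k, 'c, 'cm, 'h list, 'h list \<times> 'k mat \<times> 'h list) bimod"
  shows "restrict_right (\<lambda>y. y) M = M"
  by (simp add: restrict_right_def)

lemma convolve_map_left: "convolve f (map g X) Y = convolve (\<lambda>x. f (g x)) X Y"
  by (simp add: convolve_def comp_def)

lemma convolve_map_right: "convolve f X (map g Y) = convolve (\<lambda>x y. f x (g y)) X Y"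
  by (simp add: convolve_def comp_def)

lemma convolve_cong:
  "(\<And>x y. x \<in> set X \<Longrightarrow> y \<in> set Y \<Longrightarrow> f x y = g x y) \<Longrightarrow> convolve f X Y = convolve g X Y"
  by (auto simp: convolve_def intro!: arg_cong[of _ _ concat])

lemma smult_smult_mat: "a \<cdot>\<^sub>m (b \<cdot>\<^sub>m A) = (a * b :: 'k::semigroup_mult) \<cdot>\<^sub>m A"
  by (rule eq_matI) (simp_all add: mult.assoc)

text \<open>Degrees are pushed forward along \<open>t\<close>, while the action, being indexed by
  group elements, is pulled back along \<open>s\<close>. Restriction to \<open>C\<close> keeps it
  extensional, as objects require.\<close>

definition relabel ::
  "('h1 \<Rightarrow> 'h2) \<Rightarrow> ('h2 \<Rightarrow> 'h1) \<Rightarrow> ('g \<times> 'h2) set \<Rightarrow> ('g \<times> 'h2 \<Rightarrow> 'k::field)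
    \<Rightarrow> ('g \<times> 'h1, 'k) gmod \<Rightarrow> ('g \<times> 'h2, 'k) gmod" where
  "relabel t s C \<mu> m = (map (apsnd t) (fst m), \<lambda>c\<in>C. \<mu> c \<cdot>\<^sub>m snd m (apsnd s c))"

definition relabel_arr ::
  "('h1 \<Rightarrow> 'h2) \<Rightarrow> ('h2 \<Rightarrow> 'h1) \<Rightarrow> ('g \<times> 'h2) set \<Rightarrow> ('g \<times> 'h2 \<Rightarrow> 'k::field)
    \<Rightarrow> ('g \<times> 'h1, 'k) gmod \<times> 'k mat \<times> ('g \<times> 'h1, 'k) gmod
    \<Rightarrow> ('g \<times> 'h2, 'k) gmod \<times> 'k mat \<times> ('g \<times> 'h2, 'k) gmod" where
  "relabel_arr t s C \<mu> = (\<lambda>(m, F, n). (relabel t s C \<mu> m, F, relabel t s C \<mu> n))"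

lemma relabel_arr_simp [simp]:
  "relabel_arr t s C \<mu> (m, F, n) = (relabel t s C \<mu> m, F, relabel t s C \<mu> n)"
  by (simp add: relabel_arr_def)

text \<open>
  Cohomologous cocycles, up to the isomorphism \<open>t\<close> with inverse \<open>s\<close>, give strictly isomorphic
  module categories: the action of \<open>e\<^sub>c\<close> is rescaled by \<open>\<mu> c\<close>.
\<close>

locale cohomologous = G: group G + H1: comm_group H1 + H2: comm_group H2
  for G :: "'g monoid" and H1 :: "'h1 monoid" and H2 :: "'h2 monoid" +
  fixes t :: "'h1 \<Rightarrow> 'h2" and s :: "'h2 \<Rightarrow> 'h1" and \<mu> :: "'g \<times> 'h2 \<Rightarrow> 'k::field"
    and \<kappa>1 :: "'g \<times> 'h1 \<Rightarrow> 'g \<times> 'h1 \<Rightarrow> 'k" and \<kappa>2 :: "'g \<times> 'h2 \<Rightarrow> 'g \<times> 'h2 \<Rightarrow> 'k"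
  assumes t_hom: "t \<in> hom H1 H2" and s_hom: "s \<in> hom H2 H1"
    and s_t: "x \<in> carrier H1 \<Longrightarrow> s (t x) = x" and t_s: "y \<in> carrier H2 \<Longrightarrow> t (s y) = y"
    and \<mu>_nonzero: "c \<in> carrier G \<times> carrier H2 \<Longrightarrow> \<mu> c \<noteq> 0"
    and \<mu>_mult: "\<lbrakk>c \<in> carrier G \<times> carrier H2; d \<in> carrier G \<times> carrier H2\<rbrakk>
          \<Longrightarrow> \<mu> c * \<mu> d * \<kappa>1 (apsnd s c) (apsnd s d) = \<kappa>2 c d * \<mu> (c \<otimes>\<^bsub>G \<times>\<times> H2\<^esub> d)"
begin

abbreviation "S1 \<equiv> Sum3 G H1 (carrier G \<times> carrier H1, \<kappa>1)"
abbreviation "S2 \<equiv> Sum3 G H2 (carrier G \<times> carrier H2, \<kappa>2)"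
abbreviation "FO \<equiv> relabel t s (carrier G \<times> carrier H2) \<mu>"
abbreviation "FA \<equiv> relabel_arr t s (carrier G \<times> carrier H2) \<mu>"

sublocale S1: Sum3_groups G H1 "carrier G \<times> carrier H1" \<kappa>1
proof -
  interpret GH: group "G \<times>\<times> H1"
    by (rule DirProd_group) unfold_locales
  have "subgroup (carrier G \<times> carrier H1) (G \<times>\<times> H1)"
    using GH.subgroup_self by simp
  then show "Sum3_groups G H1 (carrier G \<times> carrier H1)"
    by (intro Sum3_groups.intro Sum3_groups_axioms.intro G.group_axioms H1.comm_group_axioms)
qed

lemma t_closed [simp]: "x \<in> carrier H1 \<Longrightarrow> t x \<in> carrier H2"
  and s_closed [simp]: "y \<in> carrier H2 \<Longrightarrow> s y \<in> carrier H1"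
  using t_hom s_hom by (auto simp: hom_def)

lemma t_mult [simp]: "x \<in> carrier H1 \<Longrightarrow> y \<in> carrier H1 \<Longrightarrow> t (x \<otimes>\<^bsub>H1\<^esub> y) = t x \<otimes>\<^bsub>H2\<^esub> t y"
  and s_mult [simp]: "x' \<in> carrier H2 \<Longrightarrow> y' \<in> carrier H2 \<Longrightarrow> s (x' \<otimes>\<^bsub>H2\<^esub> y') = s x' \<otimes>\<^bsub>H1\<^esub> s y'"
  using t_hom s_hom by (auto simp: hom_def)

lemma t_one [simp]: "t \<one>\<^bsub>H1\<^esub> = \<one>\<^bsub>H2\<^esub>" and s_one [simp]: "s \<one>\<^bsub>H2\<^esub> = \<one>\<^bsub>H1\<^esub>"
  using hom_one[OF t_hom H1.group_axioms H2.group_axioms]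
    hom_one[OF s_hom H2.group_axioms H1.group_axioms] by auto

lemma t_inv [simp]: "x \<in> carrier H1 \<Longrightarrow> t (inv\<^bsub>H1\<^esub> x) = inv\<^bsub>H2\<^esub> (t x)"
  by (metis H1.inv_closed H1.l_inv H2.inv_equality t_closed t_mult t_one)

text \<open>Evaluate \<open>\<mu>_mult\<close> at the images under \<open>t\<close> and divide by
  the values of \<open>\<mu>\<close>. This supplies the inverse of every construction below.\<close>

lemma cohomologous_sym: "cohomologous G H2 H1 s t (\<lambda>c. inverse (\<mu> (apsnd t c))) \<kappa>2 \<kappa>1"
proof (unfold_locales, goal_cases)
  case (6 c d)
  obtain a x b y where cd: "c = (a, x)" "d = (b, y)" by (cases c, cases d)
  have "\<mu> (apsnd t c) * \<mu> (apsnd t d) * \<kappa>1 c d =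
      \<kappa>2 (apsnd t c) (apsnd t d) * \<mu> (apsnd t (c \<otimes>\<^bsub>G \<times>\<times> H1\<^esub> d))"
    using 6 \<mu>_mult[of "apsnd t c" "apsnd t d"] by (auto simp: cd s_t)
  moreover have "\<mu> (apsnd t c) \<noteq> 0" "\<mu> (apsnd t d) \<noteq> 0" "\<mu> (apsnd t (c \<otimes>\<^bsub>G \<times>\<times> H1\<^esub> d)) \<noteq> 0"
    using 6 by (auto simp: cd intro!: \<mu>_nonzero)
  ultimately show ?case by (simp add: field_simps)
qed (auto simp: t_hom s_hom s_t t_s \<mu>_nonzero)

text \<open>The scalars cancel and \<open>s\<close> undoes \<open>t\<close>. The equality is strict
  because the action is an extensional function.\<close>

lemma relabel_inverse:
  assumes "m \<in> Ob S1"
  shows "relabel s t (carrier G \<times> carrier H1) (\<lambda>c. inverse (\<mu> (apsnd t c))) (FO m) = m"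
proof -
  obtain V \<rho> where m: "m = (V, \<rho>)" by (cases m)
  have V: "V \<in> lists (carrier G \<times> carrier H1)" and \<rho>: "\<rho> \<in> extensional (carrier G \<times> carrier H1)"
    using assms by (auto simp: m twisted_modules_iff)
  have "map (apsnd s) (map (apsnd t) V) = V"
    using V by (auto simp: s_t intro!: map_idI)
  moreover have "(\<lambda>c\<in>carrier G \<times> carrier H1. inverse (\<mu> (apsnd t c)) \<cdot>\<^sub>m
      (\<lambda>c\<in>carrier G \<times> carrier H2. \<mu> c \<cdot>\<^sub>m \<rho> (apsnd s c)) (apsnd t c)) = \<rho>"
  proof (rule extensionalityI[OF _ \<rho>])
    fix c assume c: "c \<in> carrier G \<times> carrier H1"
    then have "apsnd t c \<in> carrier G \<times> carrier H2" "apsnd s (apsnd t c) = c"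
      by (auto simp: s_t)
    then show "(\<lambda>c\<in>carrier G \<times> carrier H1. inverse (\<mu> (apsnd t c)) \<cdot>\<^sub>m
      (\<lambda>c\<in>carrier G \<times> carrier H2. \<mu> c \<cdot>\<^sub>m \<rho> (apsnd s c)) (apsnd t c)) c = \<rho> c"
      using c \<mu>_nonzero[of "apsnd t c"] by (auto simp: smult_smult_mat intro!: eq_matI)
  qed simp
  ultimately show ?thesis by (simp add: m relabel_def)
qed

lemma homogeneous_relabel:
  assumes "homogeneous (G \<times>\<times> H1) (apsnd s c) V W P" and "V \<in> lists (carrier G \<times> carrier H1)"
    and "c \<in> carrier G \<times> carrier H2"
  shows "homogeneous (G \<times>\<times> H2) c (map (apsnd t) V) (map (apsnd t) W) P"
proof -
  have "apsnd t (v \<otimes>\<^bsub>G \<times>\<times> H1\<^esub> apsnd s c) = apsnd t v \<otimes>\<^bsub>G \<times>\<times> H2\<^esub> c" if "v \<in> set V" for v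
    using that assms(2,3) by (auto simp: t_s in_lists_conv_set dest!: bspec)
  then show ?thesis
    using assms(1) by (auto simp: homogeneous_def)
qed

text \<open>\<open>\<mu>_mult\<close> is exactly the condition for the rescaled operators to satisfy
  the relations twisted by \<open>\<kappa>2\<close>. At the unit, after cancelling
  \<open>\<mu> 1\<close>, it also gives the value required of the unit operator.\<close>

lemma relabel_closed:
  assumes "m \<in> Ob S1"
  shows "FO m \<in> Ob S2"
proof -
  obtain V \<rho> where m: "m = (V, \<rho>)" by (cases m)
  have V: "V \<in> lists (carrier G \<times> carrier H1)"
    and hom: "\<And>c. c \<in> carrier G \<times> carrier H1 \<Longrightarrow> homogeneous (G \<times>\<times> H1) c V V (\<rho> c)"
    and one: "\<rho> \<one>\<^bsub>G \<times>\<times> H1\<^esub> = \<kappa>1 \<one>\<^bsub>G \<times>\<times> H1\<^esub> \<one>\<^bsub>G \<times>\<times> H1\<^esub> \<cdot>\<^sub>m 1\<^sub>m (length V)"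
    and mult: "\<And>c d. c \<in> carrier G \<times> carrier H1 \<Longrightarrow> d \<in> carrier G \<times> carrier H1
      \<Longrightarrow> \<rho> d * \<rho> c = \<kappa>1 c d \<cdot>\<^sub>m \<rho> (c \<otimes>\<^bsub>G \<times>\<times> H1\<^esub> d)"
    using assms by (auto simp: m twisted_modules_iff)
  let ?\<rho> = "\<lambda>c\<in>carrier G \<times> carrier H2. \<mu> c \<cdot>\<^sub>m \<rho> (apsnd s c)"
  have dim: "\<rho> c \<in> carrier_mat (length V) (length V)" if "c \<in> carrier G \<times> carrier H1" for c
    using hom[OF that] by (simp add: homogeneous_def)
  have s_carrier: "apsnd s c \<in> carrier G \<times> carrier H1" if "c \<in> carrier G \<times> carrier H2" for c
    using that by auto
  have s_m: "apsnd s (c \<otimes>\<^bsub>G \<times>\<times> H2\<^esub> d) = apsnd s c \<otimes>\<^bsub>G \<times>\<times> H1\<^esub> apsnd s d"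
    if "c \<in> carrier G \<times> carrier H2" "d \<in> carrier G \<times> carrier H2" for c d
    using that by auto
  have closed: "c \<otimes>\<^bsub>G \<times>\<times> H2\<^esub> d \<in> carrier G \<times> carrier H2"
    if "c \<in> carrier G \<times> carrier H2" "d \<in> carrier G \<times> carrier H2" for c d
    using that by auto
  have "homogeneous (G \<times>\<times> H2) c (map (apsnd t) V) (map (apsnd t) V) (?\<rho> c)"
    if c: "c \<in> carrier G \<times> carrier H2" for c
  proof (rule homogeneous_relabel[OF _ V c])
    show "homogeneous (G \<times>\<times> H1) (apsnd s c) V V (?\<rho> c)"
      using c hom[OF s_carrier[OF c]] by (auto simp: homogeneous_def)
  qed
  moreover have "?\<rho> \<one>\<^bsub>G \<times>\<times> H2\<^esub> = \<kappa>2 \<one>\<^bsub>G \<times>\<times> H2\<^esub> \<one>\<^bsub>G \<times>\<times> H2\<^esub> \<cdot>\<^sub>m 1\<^sub>m (length V)"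
  proof -
    have 1: "\<one>\<^bsub>G \<times>\<times> H2\<^esub> \<in> carrier G \<times> carrier H2" by simp
    have "\<mu> \<one>\<^bsub>G \<times>\<times> H2\<^esub> * \<kappa>1 \<one>\<^bsub>G \<times>\<times> H1\<^esub> \<one>\<^bsub>G \<times>\<times> H1\<^esub> = \<kappa>2 \<one>\<^bsub>G \<times>\<times> H2\<^esub> \<one>\<^bsub>G \<times>\<times> H2\<^esub>"
      using \<mu>_mult[OF 1 1] \<mu>_nonzero[OF 1] by (simp add: mult.assoc)
    then show ?thesis using one by (simp add: smult_smult_mat)
  qed
  moreover have "?\<rho> d * ?\<rho> c = \<kappa>2 c d \<cdot>\<^sub>m ?\<rho> (c \<otimes>\<^bsub>G \<times>\<times> H2\<^esub> d)"
    if c: "c \<in> carrier G \<times> carrier H2" and d: "d \<in> carrier G \<times> carrier H2" for c d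
  proof -
    have "(\<mu> d \<cdot>\<^sub>m A) * (\<mu> c \<cdot>\<^sub>m B) = (\<mu> c * \<mu> d) \<cdot>\<^sub>m (A * B)"
      if "A \<in> carrier_mat (length V) (length V)" "B \<in> carrier_mat (length V) (length V)" for A B
      using that mult_smult_assoc_mat[OF that(1) smult_carrier_mat[OF that(2)]]
        mult_smult_distrib[OF that] by (simp add: smult_smult_mat mult.commute)
    then have "?\<rho> d * ?\<rho> c = (\<mu> c * \<mu> d) \<cdot>\<^sub>m (\<rho> (apsnd s d) * \<rho> (apsnd s c))"
      using c d dim[OF s_carrier[OF c]] dim[OF s_carrier[OF d]] by simp
    also have "\<dots> = \<kappa>2 c d \<cdot>\<^sub>m ?\<rho> (c \<otimes>\<^bsub>G \<times>\<times> H2\<^esub> d)"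
      using c d closed[OF c d]
      by (simp add: mult s_carrier s_m smult_smult_mat \<mu>_mult)
    finally show ?thesis .
  qed
  moreover have "map (apsnd t) V \<in> lists (carrier G \<times> carrier H2)"
    using V by (auto simp: in_lists_conv_set dest!: bspec)
  ultimately show ?thesis
    by (simp add: m relabel_def twisted_modules_iff del: one_DirProd)
qed

lemma Ob_S1_carrier_mat:
  assumes "m \<in> Ob S1" "c \<in> carrier G \<times> carrier H1"
  shows "snd m c \<in> carrier_mat (length (fst m)) (length (fst m))"
proof (cases m)
  case (Pair V \<rho>)
  have "\<forall>c \<in> carrier G \<times> carrier H1. homogeneous (G \<times>\<times> H1) c V V (\<rho> c)"
    using assms(1) unfolding Pair Sum3_simps twisted_modules_iff by blast
  then have "homogeneous (G \<times>\<times> H1) c V V (\<rho> c)"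
    using assms(2) by (rule bspec)
  then show ?thesis unfolding homogeneous_def Pair by simp
qed

text \<open>The matrix need not change: both sides of the intertwining relation acquire the same
  scalar \<open>\<mu> c\<close>.\<close>

lemma relabel_arr_closed:
  assumes "h \<in> Hom S1 m n"
  shows "FA h \<in> Hom S2 (FO m) (FO n)"
proof -
  obtain F where h: "h = (m, F, n)" and mn: "m \<in> Ob S1" "n \<in> Ob S1"
    and F: "homogeneous (G \<times>\<times> H1) \<one>\<^bsub>G \<times>\<times> H1\<^esub> (fst m) (fst n) F"
    and comm: "\<And>c. c \<in> carrier G \<times> carrier H1 \<Longrightarrow> F * snd m c = snd n c * F"
    using assms by (auto simp: Hom_Sum3 Arr_Sum3)
  have "fst m \<in> lists (carrier G \<times> carrier H1)"
    using mn(1) by (cases m) (simp add: twisted_modules_iff)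
  then have "homogeneous (G \<times>\<times> H2) \<one>\<^bsub>G \<times>\<times> H2\<^esub> (fst (FO m)) (fst (FO n)) F"
    using homogeneous_relabel[of "\<one>\<^bsub>G \<times>\<times> H2\<^esub>" "fst m" "fst n" F] F by (simp add: relabel_def)
  moreover have "F * snd (FO m) c = snd (FO n) c * F" if c: "c \<in> carrier G \<times> carrier H2" for c
  proof -
    have s: "apsnd s c \<in> carrier G \<times> carrier H1" using c by auto
    have "F \<in> carrier_mat (length (fst n)) (length (fst m))"
      using F by (simp add: homogeneous_def)
    moreover have "snd m (apsnd s c) \<in> carrier_mat (length (fst m)) (length (fst m))"
      "snd n (apsnd s c) \<in> carrier_mat (length (fst n)) (length (fst n))"
      using mn s by (simp_all add: Ob_S1_carrier_mat)
    ultimately show ?thesis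
      using c comm[OF s] by (simp add: relabel_def mult_smult_assoc_mat mult_smult_distrib)
  qed
  ultimately show ?thesis
    using relabel_closed[OF mn(1)] relabel_closed[OF mn(2)] by (simp add: h Hom_Sum3 Arr_Sum3)
qed

text \<open>No typing is involved, since the left action changes only the first degree and
  relabelling only the second.\<close>

lemma relabel_LActO: "FO (LActO S1 X m) = LActO S2 X (FO m)"
  by (auto simp: LActO_Sum3 relabel_def map_convolve convolve_map_right split_beta
      kron_smult_right apsnd_def map_prod_def intro!: convolve_cong restrict_ext)

text \<open>Here both operations touch the second degree, so \<open>t\<close> must be a homomorphism
  on the degrees that occur.\<close>

lemma relabel_RActO:
  assumes "m \<in> Ob S1" "Y \<in> lists (carrier H1)"
  shows "FO (RActO S1 m Y) = RActO S2 (FO m) (map t Y)"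
proof -
  have "set (fst m) \<subseteq> carrier G \<times> carrier H1"
    using assms(1) by (cases m) (auto simp: twisted_modules_iff)
  then show ?thesis
    using assms(2)
    by (auto simp: RActO_Sum3 relabel_def map_convolve convolve_map_left convolve_map_right
        kron_smult_left intro!: convolve_cong restrict_ext)
qed

lemma map_t_convolve:
  assumes "X \<in> lists (carrier H1)" "Y \<in> lists (carrier H1)"
  shows "map t (convolve (monoid.mult H1) X Y) = convolve (monoid.mult H2) (map t X) (map t Y)"
  using assms by (auto simp: map_convolve convolve_map_left convolve_map_right in_lists_conv_set
      intro!: convolve_cong)

text \<open>Two restriction maps out of a third group \<open>K\<close> are allowed so that either
  side may be the restricted one; \<open>h2 = t \<circ> h1\<close> makes the right actions
  correspond.\<close>

lemma strict_iso_relabel: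
  assumes h1: "\<And>x. x \<in> carrier K \<Longrightarrow> h1 x \<in> carrier H1"
    and h2: "\<And>x. x \<in> carrier K \<Longrightarrow> h2 x = t (h1 x)"
  shows "strict_bimodule_iso (Vect G) (Vect K) (restrict_right h1 S1) (restrict_right h2 S2) FO FA"
proof -
  interpret sym: cohomologous G H2 H1 s t "\<lambda>c. inverse (\<mu> (apsnd t c))" \<kappa>2 \<kappa>1
    by (rule cohomologous_sym)
  have inv1: "sym.FO (FO m) = m" if "m \<in> Ob S1" for m
    using that by (rule relabel_inverse)
  \<comment> \<open>Applying the symmetry twice yields the scalar
    \<open>inverse (inverse (\<mu> (apsnd t (apsnd s c))))\<close>, which is identified with
    \<open>\<mu> c\<close> only on the carrier, hence under the restriction.\<close>
  have inv2: "FO (sym.FO n) = n" if n: "n \<in> Ob S2" for n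
  proof -
    have "relabel t s (carrier G \<times> carrier H2) (\<lambda>c. inverse (inverse (\<mu> (apsnd t (apsnd s c))))) (sym.FO n) = n"
      using n by (rule sym.relabel_inverse)
    moreover have "(\<lambda>c\<in>carrier G \<times> carrier H2. inverse (inverse (\<mu> (apsnd t (apsnd s c)))) \<cdot>\<^sub>m Q c) =
        (\<lambda>c\<in>carrier G \<times> carrier H2. \<mu> c \<cdot>\<^sub>m Q c)" for Q :: "_ \<Rightarrow> 'k mat"
      by (rule restrict_ext) (auto simp: t_s)
    ultimately show ?thesis by (simp add: relabel_def)
  qed
  have map_h: "map (t \<circ> h1) Y = map h2 Y" "map h1 Y \<in> lists (carrier H1)"
    if "Y \<in> lists (carrier K)" for Y
    using that h1 h2 by auto
  have Ob_Arr: "m \<in> Ob S1 \<and> n \<in> Ob S1" if "(m, F, n) \<in> Arr S1" for m F n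
    using that by (simp add: Arr_Sum3)
  show ?thesis
  proof (unfold_locales, goal_cases)
    case (1 h)
    then show ?case by (cases h) (simp add: Arr_Sum3)
  next
    case 2
    show ?case
      by (rule bij_betw_byWitness[where f' = sym.FO])
        (use inv1 inv2 relabel_closed sym.relabel_closed in auto)
  next
    case (3 m n)
    then have mn: "m \<in> Ob S1" "n \<in> Ob S1" by auto
    \<comment> \<open>Arrows record their end points, so the inverse lands in this hom-set only
      because \<open>sym.FO\<close> undoes \<open>FO\<close> strictly on \<open>m\<close> and
      \<open>n\<close>.\<close>
    have "sym.FA h \<in> Hom S1 m n" if "h \<in> Hom S2 (FO m) (FO n)" for h
      using sym.relabel_arr_closed[OF that] inv1[OF mn(1)] inv1[OF mn(2)] by simp
    moreover have "FA (sym.FA h) = h" if "h \<in> Hom S2 (FO m) (FO n)" for h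
      using that inv1[OF mn(1)] inv1[OF mn(2)] by (auto simp: Hom_Sum3)
    moreover have "sym.FA (FA h) = h" if "h \<in> Hom S1 m n" for h
      using that inv1[OF mn(1)] inv1[OF mn(2)] by (auto simp: Hom_Sum3)
    ultimately have "bij_betw FA (Hom S1 m n) (Hom S2 (FO m) (FO n))"
      by (intro bij_betw_byWitness[where f' = sym.FA] ballI image_subsetI)
        (use relabel_arr_closed in blast)+
    then show ?case by simp
  next
    case (4 m)
    show ?case by (simp add: relabel_def)
  next
    case (5 g h)
    show ?case by (cases g, cases h) simp
  next
    case (6 g h)
    show ?case by (cases g, cases h) simp
  next
    case (7 a h)
    show ?case by (cases h) simp
  next
    case (8 X m)
    show ?case by (simp add: relabel_LActO)
  next
    case (9 f h)
    show ?case by (cases f, cases h) (simp add: relabel_LActO)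
  next
    case (10 m P)
    then show ?case by (simp add: relabel_RActO map_h)
  next
    case (11 h v)
    obtain m F n Y P Y' where hv: "h = (m, F, n)" "v = (Y, P, Y')" by (cases h, cases v)
    show ?case
      using 11 Ob_Arr[of m F n] by (simp add: hv Arr_Vect relabel_RActO map_h)
  next
    case (12 X Y m)
    \<comment> \<open>Once relabelling has passed through the actions, what remains is that it
      preserves lengths, hence the sizes of identity matrices.\<close>
    show ?case by (simp add: relabel_LActO) (simp add: relabel_def)
  next
    case (13 m)
    show ?case by (simp add: relabel_LActO) (simp add: relabel_def)
  next
    case (14 m P Q)
    have "RActO S1 m (map h1 P) \<in> Ob S1"
      using 14 by (intro S1.RActO_closed) (simp_all add: map_h)
    moreover have "convolve (monoid.mult H1) (map h1 P) (map h1 Q) \<in> lists (carrier H1)"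
      using 14 h1 by (auto simp: set_convolve)
    ultimately show ?case
      using 14 by (simp add: relabel_RActO map_t_convolve map_h) (simp add: relabel_def)
  next
    case (15 m)
    show ?case using 15 relabel_RActO[of m "[\<one>\<^bsub>H1\<^esub>]"] by simp (simp add: relabel_def)
  next
    case (16 X m P)
    then show ?case
      using S1.LActO_closed[of X m] by (simp add: relabel_LActO relabel_RActO map_h) (simp add: relabel_def)
  qed
qed

end


section \<open>The element \<open>T\<^sub>\<sigma>\<close> and the Fourier transform\<close>

lemma carrier_dual_iff:
  "\<phi> \<in> carrier (dual L) \<longleftrightarrow> \<phi> \<in> extensional (carrier L) \<and> (\<forall>x \<in> carrier L. \<phi> x \<noteq> 0) \<and>
     (\<forall>x \<in> carrier L. \<forall>y \<in> carrier L. \<phi> (x \<otimes>\<^bsub>L\<^esub> y) = \<phi> x * \<phi> y)"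
  by (auto simp: dual_def hom_def units_group_def)

lemma mult_dual: "\<phi> \<otimes>\<^bsub>dual L\<^esub> \<psi> = (\<lambda>x\<in>carrier L. \<phi> x * \<psi> x)"
  and one_dual: "\<one>\<^bsub>dual L\<^esub> = (\<lambda>x\<in>carrier L. 1)"
  by (simp_all add: dual_def)

lemma comm_group_dual:
  assumes "monoid L"
  shows "comm_group (dual L)"
proof (rule comm_groupI, goal_cases)
  interpret monoid L by fact
  {
    case (1 x y)
    then show ?case by (auto simp: carrier_dual_iff mult_dual)
  next
    case 2
    show ?case by (auto simp: carrier_dual_iff one_dual)
  next
    case (3 x y z)
    then show ?case by (auto simp: mult_dual intro!: restrict_ext)
  next
    case (4 x y)
    then show ?case by (auto simp: mult_dual mult.commute)
  next
    case (5 x)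
    then show ?case by (auto simp: carrier_dual_iff mult_dual one_dual extensional_def)
  next
    case (6 x)
    then show ?case
      by (intro bexI[of _ "\<lambda>l\<in>carrier L. inverse (x l)"])
        (auto simp: carrier_dual_iff mult_dual one_dual)
  }
qed

locale symmetric_self_duality = L: comm_group L
  for L :: "'l monoid" +
  fixes \<sigma> :: "'l \<Rightarrow> 'l \<Rightarrow> 'k::alg_closed_field"
  assumes finite: "finite (carrier L)"
    and \<sigma>_iso: "\<sigma> \<in> iso L (dual L)"
    and \<sigma>_sym: "\<lbrakk>k \<in> carrier L; l \<in> carrier L\<rbrakk> \<Longrightarrow> \<sigma> l k = \<sigma> k l"
begin

sublocale dual: comm_group "dual L :: ('l \<Rightarrow> 'k) monoid"
  by (rule comm_group_dual) unfold_locales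

abbreviation \<sigma>_inv :: "('l \<Rightarrow> 'k) \<Rightarrow> 'l" where "\<sigma>_inv \<equiv> inv_into (carrier L) \<sigma>"

lemma \<sigma>_bij: "bij_betw \<sigma> (carrier L) (carrier (dual L))"
  using \<sigma>_iso by (simp add: iso_def)

lemma \<sigma>_closed [simp]: "l \<in> carrier L \<Longrightarrow> \<sigma> l \<in> carrier (dual L)"
  and \<sigma>_inv_closed [simp]: "\<phi> \<in> carrier (dual L) \<Longrightarrow> \<sigma>_inv \<phi> \<in> carrier L"
  and \<sigma>_inv_\<sigma> [simp]: "l \<in> carrier L \<Longrightarrow> \<sigma>_inv (\<sigma> l) = l"
  and \<sigma>_\<sigma>_inv [simp]: "\<phi> \<in> carrier (dual L) \<Longrightarrow> \<sigma> (\<sigma>_inv \<phi>) = \<phi>"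
  using \<sigma>_bij by (auto simp: bij_betw_def inv_into_into f_inv_into_f)

lemma \<sigma>_mult [simp]:
  "k \<in> carrier L \<Longrightarrow> l \<in> carrier L \<Longrightarrow> \<sigma> (k \<otimes>\<^bsub>L\<^esub> l) = \<sigma> k \<otimes>\<^bsub>dual L\<^esub> \<sigma> l"
  using \<sigma>_iso by (simp add: iso_def hom_def)

lemma \<sigma>_inv_mult [simp]:
  assumes "\<phi> \<in> carrier (dual L)" "\<psi> \<in> carrier (dual L)"
  shows "\<sigma>_inv (\<phi> \<otimes>\<^bsub>dual L\<^esub> \<psi>) = \<sigma>_inv \<phi> \<otimes>\<^bsub>L\<^esub> \<sigma>_inv \<psi>"
  using assms \<sigma>_inv_\<sigma>[of "\<sigma>_inv \<phi> \<otimes>\<^bsub>L\<^esub> \<sigma>_inv \<psi>"] by simp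

lemma \<sigma>_nonzero [simp]: "k \<in> carrier L \<Longrightarrow> l \<in> carrier L \<Longrightarrow> \<sigma> k l \<noteq> 0"
  and \<sigma>_apply_mult [simp]: "\<lbrakk>k \<in> carrier L; l \<in> carrier L; l' \<in> carrier L\<rbrakk>
    \<Longrightarrow> \<sigma> k (l \<otimes>\<^bsub>L\<^esub> l') = \<sigma> k l * \<sigma> k l'"
  using \<sigma>_closed[of k] unfolding carrier_dual_iff by blast+

lemma \<sigma>_mult_apply [simp]: "\<lbrakk>k \<in> carrier L; k' \<in> carrier L; l \<in> carrier L\<rbrakk>
    \<Longrightarrow> (\<sigma> k \<otimes>\<^bsub>dual L\<^esub> \<sigma> k') l = \<sigma> k l * \<sigma> k' l"
  by (simp add: mult_dual)

lemma \<sigma>_inv_apply: "\<lbrakk>k \<in> carrier L; l \<in> carrier L\<rbrakk> \<Longrightarrow> \<sigma> (inv\<^bsub>L\<^esub> k) l = inverse (\<sigma> k l)"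
proof -
  assume kl: "k \<in> carrier L" "l \<in> carrier L"
  have mult: "\<sigma> (a \<otimes>\<^bsub>L\<^esub> b) l = \<sigma> a l * \<sigma> b l" if "a \<in> carrier L" "b \<in> carrier L" for a b
    using that kl by simp
  have "\<sigma> \<one>\<^bsub>L\<^esub> l * \<sigma> \<one>\<^bsub>L\<^esub> l = \<sigma> \<one>\<^bsub>L\<^esub> l"
    using mult[of "\<one>\<^bsub>L\<^esub>" "\<one>\<^bsub>L\<^esub>"] by simp
  \<comment> \<open>A nonzero idempotent of a field is 1.\<close>
  then have "\<sigma> \<one>\<^bsub>L\<^esub> l = 1"
    using kl by simp
  then show ?thesis
    using kl mult[of k "inv\<^bsub>L\<^esub> k"] by (simp add: inverse_unique del: \<sigma>_mult)
qed

section \<open>The involution \<open>T_sigma\<close>, its graph and its alternating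
  bicharacter\<close>

lemma T_sigma_apply [simp]:
  "l \<in> carrier L \<Longrightarrow> \<phi> \<in> carrier (dual L) \<Longrightarrow> T_sigma L \<sigma> (l, \<phi>) = (\<sigma>_inv \<phi>, \<sigma> l)"
  by (simp add: T_sigma_def)

lemma T_sigma_involutive:
  "x \<in> carrier L \<times> carrier (dual L) \<Longrightarrow> T_sigma L \<sigma> (T_sigma L \<sigma> x) = x"
  by auto

lemma T_sigma_Bij: "T_sigma L \<sigma> \<in> Bij (carrier L \<times> carrier (dual L))"
proof -
  have "bij_betw (T_sigma L \<sigma>) (carrier L \<times> carrier (dual L)) (carrier L \<times> carrier (dual L))"
    by (rule bij_betw_byWitness[where f' = "T_sigma L \<sigma>"]) auto
  then show ?thesis by (simp add: Bij_def T_sigma_def)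
qed

text \<open>The form at the image of \<open>(l, \<phi>)\<close> is
  \<open>\<sigma> l (\<sigma>_inv \<phi>)\<close>. Symmetry of \<sigma> turns this into
  \<open>\<sigma> (\<sigma>_inv \<phi>) l\<close>, which is \<open>\<phi> l\<close>.\<close>

lemma T_sigma_in_orthogonal_group: "T_sigma L \<sigma> \<in> carrier (orthogonal_group L)"
proof -
  have "T_sigma L \<sigma> \<in> auto (L \<times>\<times> dual L)"
    using T_sigma_Bij by (auto simp: auto_def hom_def)
  moreover have "ev (T_sigma L \<sigma> (l, \<phi>)) = ev (l, \<phi>)"
    if "l \<in> carrier L" "\<phi> \<in> carrier (dual L)" for l \<phi>
    using that \<sigma>_sym[of "\<sigma>_inv \<phi>" l] by (simp add: ev_def)
  ultimately show ?thesis
    by (auto simp: orthogonal_group_def)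
qed

lemma T_sigma_square: "T_sigma L \<sigma> \<otimes>\<^bsub>orthogonal_group L\<^esub> T_sigma L \<sigma> = \<one>\<^bsub>orthogonal_group L\<^esub>"
  using T_sigma_Bij
  by (auto simp: orthogonal_group_def AutoGroup_def BijGroup_def compose_def T_sigma_involutive
      intro!: restrict_ext simp del: T_sigma_apply)

text \<open>The point \<open>(l, \<sigma> 1)\<close> is sent to \<open>(1, \<sigma> l)\<close>, so
  it can be fixed only for trivial \<open>l\<close>. Together with \<open>T_sigma_square\<close> the
  order is exactly two.\<close>

lemma T_sigma_nontrivial:
  assumes "carrier L \<noteq> {\<one>\<^bsub>L\<^esub>}"
  shows "T_sigma L \<sigma> \<noteq> \<one>\<^bsub>orthogonal_group L\<^esub>"
proof
  assume eq: "T_sigma L \<sigma> = \<one>\<^bsub>orthogonal_group L\<^esub>"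
  obtain l where l: "l \<in> carrier L" "l \<noteq> \<one>\<^bsub>L\<^esub>"
    using assms L.one_closed by blast
  have "T_sigma L \<sigma> (l, \<sigma> \<one>\<^bsub>L\<^esub>) = (l, \<sigma> \<one>\<^bsub>L\<^esub>)"
    unfolding eq using l by (simp add: orthogonal_group_def AutoGroup_def BijGroup_def)
  then show False using l by simp
qed

text \<open>The second coordinate is \<open>\<sigma>_inv \<phi>\<close>, which ranges over all of
  \<open>L\<close> independently of the first.\<close>

lemma graph_projection_T_sigma: "graph_projection L (T_sigma L \<sigma>) = carrier L \<times> carrier L"
proof -
  have "(l, k) \<in> graph_projection L (T_sigma L \<sigma>)" if "l \<in> carrier L" "k \<in> carrier L" for l k
    unfolding graph_projection_def
    by (rule image_eqI[where x = "(l, \<sigma> k)"]) (use that in simp_all)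
  then show ?thesis
    by (auto simp: graph_projection_def)
qed

text \<open>The choice in \<open>chi\<close> is forced: \<open>\<sigma> k1\<close> is the only
  character that \<open>\<sigma>_inv\<close> sends to \<open>k1\<close>. The corresponding \<psi> is
  \<open>\<sigma> l1\<close>.\<close>

lemma chi_T_sigma:
  assumes "l1 \<in> carrier L" "k1 \<in> carrier L"
  shows "chi L (T_sigma L \<sigma>) (l1, k1) (l2, k2) = \<sigma> k1 l2 * inverse (\<sigma> l1 k2)"
proof -
  have "(SOME \<phi>. \<phi> \<in> carrier (dual L) \<and> fst (T_sigma L \<sigma> (l1, \<phi>)) = k1) = \<sigma> k1"
    by (rule some_equality) (use assms in auto)
  then show ?thesis using assms by (simp add: chi_def Let_def)
qed

section \<open>The transported Heisenberg cocycle and the comparison of the two categories\<close>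

definition \<kappa>_FT :: "'l \<times> 'l \<Rightarrow> 'l \<times> 'l \<Rightarrow> 'k" where
  "\<kappa>_FT = (\<lambda>(l1, k1) (l2, k2). inverse (\<sigma> k2 l1))"

text \<open>A bicharacter satisfies the cocycle identity: both sides expand to the product of its
  values at the three ordered pairs.\<close>

lemma cocycle2_\<kappa>_FT: "cocycle2 (L \<times>\<times> L) (carrier L \<times> carrier L) \<kappa>_FT"
  by (auto simp: cocycle2_def \<kappa>_FT_def)

lemma alt_\<kappa>_FT:
  assumes "x \<in> carrier L \<times> carrier L" "y \<in> carrier L \<times> carrier L"
  shows "alt \<kappa>_FT x y = chi L (T_sigma L \<sigma>) x y"
  using assms by (auto simp: alt_def \<kappa>_FT_def chi_T_sigma \<sigma>_sym)

text \<open>Two cocycles with the same alternating bicharacter differ by a symmetric one.\<close>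

lemma C_corr_T_sigma:
  obtains \<kappa> \<nu> where "C_corr L (T_sigma L \<sigma>) = (carrier L \<times> carrier L, \<kappa>)"
    "\<And>a. a \<in> carrier L \<times> carrier L \<Longrightarrow> \<nu> a \<noteq> 0"
    "\<And>a b. \<lbrakk>a \<in> carrier L \<times> carrier L; b \<in> carrier L \<times> carrier L\<rbrakk>
      \<Longrightarrow> \<nu> a * \<nu> b * \<kappa>_FT a b = \<kappa> a b * \<nu> (a \<otimes>\<^bsub>L \<times>\<times> L\<^esub> b)"
proof -
  let ?A = "carrier L \<times> carrier L"
  define \<kappa> where "\<kappa> = snd (C_corr L (T_sigma L \<sigma>))"
  have C: "C_corr L (T_sigma L \<sigma>) = (?A, \<kappa>)"
    by (simp add: \<kappa>_def C_corr_def graph_projection_T_sigma)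
  have "cocycle2 (L \<times>\<times> L) ?A \<kappa> \<and> (\<forall>x \<in> ?A. \<forall>y \<in> ?A. alt \<kappa> x y = chi L (T_sigma L \<sigma>) x y)"
    unfolding \<kappa>_def C_corr_def graph_projection_T_sigma snd_conv
    \<comment> \<open>The Heisenberg cocycle itself witnesses that the choice in
      \<open>C_corr\<close> is made from a nonempty set.\<close>
    by (rule someI[where x = \<kappa>_FT]) (use cocycle2_\<kappa>_FT alt_\<kappa>_FT in blast)
  then have coc: "cocycle2 (L \<times>\<times> L) ?A \<kappa>"
    and alt: "\<And>x y. x \<in> ?A \<Longrightarrow> y \<in> ?A \<Longrightarrow> alt \<kappa> x y = alt \<kappa>_FT x y"
    using alt_\<kappa>_FT by auto
  define \<beta> where "\<beta> a b = \<kappa> a b * inverse (\<kappa>_FT a b)" for a b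
  have nz: "\<kappa> a b \<noteq> 0" "\<kappa>_FT a b \<noteq> 0" if "a \<in> ?A" "b \<in> ?A" for a b
    using coc cocycle2_\<kappa>_FT that unfolding cocycle2_def by blast+
  have cocycles: "\<kappa> a b * \<kappa> (a \<otimes>\<^bsub>L \<times>\<times> L\<^esub> b) c = \<kappa> a (b \<otimes>\<^bsub>L \<times>\<times> L\<^esub> c) * \<kappa> b c"
    "\<kappa>_FT a b * \<kappa>_FT (a \<otimes>\<^bsub>L \<times>\<times> L\<^esub> b) c = \<kappa>_FT a (b \<otimes>\<^bsub>L \<times>\<times> L\<^esub> c) * \<kappa>_FT b c"
    if "a \<in> ?A" "b \<in> ?A" "c \<in> ?A" for a b c
    using coc cocycle2_\<kappa>_FT that unfolding cocycle2_def by blast+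
  have "\<beta> a b * \<beta> (a \<otimes>\<^bsub>L \<times>\<times> L\<^esub> b) c = \<beta> a (b \<otimes>\<^bsub>L \<times>\<times> L\<^esub> c) * \<beta> b c"
    if "a \<in> ?A" "b \<in> ?A" "c \<in> ?A" for a b c
  proof -
    have "\<beta> a b * \<beta> (a \<otimes>\<^bsub>L \<times>\<times> L\<^esub> b) c =
        \<kappa> a b * \<kappa> (a \<otimes>\<^bsub>L \<times>\<times> L\<^esub> b) c * inverse (\<kappa>_FT a b * \<kappa>_FT (a \<otimes>\<^bsub>L \<times>\<times> L\<^esub> b) c)"
      by (simp add: \<beta>_def mult_ac)
    also have "\<dots> = \<beta> a (b \<otimes>\<^bsub>L \<times>\<times> L\<^esub> c) * \<beta> b c"
      unfolding cocycles[OF that] by (simp add: \<beta>_def mult_ac)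
    finally show ?thesis .
  qed
  then have \<beta>_cocycle: "cocycle2 (L \<times>\<times> L) (carrier (L \<times>\<times> L)) \<beta>"
    using nz unfolding cocycle2_def by (simp add: \<beta>_def)
  have \<beta>_sym: "\<beta> a b = \<beta> b a" if "a \<in> carrier (L \<times>\<times> L)" "b \<in> carrier (L \<times>\<times> L)" for a b
    using that alt[of a b] nz[of a b] nz[of b a]
    by (simp add: alt_def \<beta>_def field_simps)
  have LL: "comm_group (L \<times>\<times> L)"
  proof -
    interpret LL: group "L \<times>\<times> L"
      by (rule DirProd_group) unfold_locales
    show ?thesis
      by (rule LL.group_comm_groupI) (auto simp: L.m_comm)
  qed
  have "finite (carrier (L \<times>\<times> L))"
    using finite by simp
  then obtain \<nu> where \<nu>: "\<And>a. a \<in> carrier (L \<times>\<times> L) \<Longrightarrow> \<nu> a \<noteq> 0"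
    "\<And>a b. a \<in> carrier (L \<times>\<times> L) \<Longrightarrow> b \<in> carrier (L \<times>\<times> L)
      \<Longrightarrow> \<nu> a * \<nu> b = \<beta> a b * \<nu> (a \<otimes>\<^bsub>L \<times>\<times> L\<^esub> b)"
    using symmetric_cocycle_is_coboundary[OF LL _ \<beta>_cocycle \<beta>_sym] by blast
  have cob: "\<nu> a * \<nu> b * \<kappa>_FT a b = \<kappa> a b * \<nu> (a \<otimes>\<^bsub>L \<times>\<times> L\<^esub> b)" if "a \<in> ?A" "b \<in> ?A" for a b
    using \<nu>(2)[of a b] nz[OF that] that by (simp add: \<beta>_def)
  show thesis
    using that[OF C _ cob] \<nu>(1) by simp
qed

definition to_dual :: "'l \<Rightarrow> 'l \<Rightarrow> 'k" where
  "to_dual k = \<sigma> (inv\<^bsub>L\<^esub> k)"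

definition from_dual :: "('l \<Rightarrow> 'k) \<Rightarrow> 'l" where
  "from_dual \<phi> = inv\<^bsub>L\<^esub> (\<sigma>_inv \<phi>)"

text \<open>An arbitrary \<open>N\<close> in the first clause yields equality of the equivalence
  classes. Those contain only invertible categories, so the second clause compares the two bimodule
  categories themselves.\<close>

lemma equivalent_Sum3_C_corr_iff_FT_sigma:
  "bimodule_equivalent (Vect L) (Vect L) N (Sum3 L L (C_corr L (T_sigma L \<sigma>))) \<longleftrightarrow>
   bimodule_equivalent (Vect L) (Vect L) N (FT_sigma L \<sigma>)"
  and equivalent_Sum3_C_corr_FT_sigma:
  "bimodule_equivalent (Vect L) (Vect L) (Sum3 L L (C_corr L (T_sigma L \<sigma>))) (FT_sigma L \<sigma>)"
proof -
  obtain \<kappa> \<nu> where C: "C_corr L (T_sigma L \<sigma>) = (carrier L \<times> carrier L, \<kappa>)"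
    and \<nu>: "\<And>a. a \<in> carrier L \<times> carrier L \<Longrightarrow> \<nu> a \<noteq> 0"
      "\<And>a b. \<lbrakk>a \<in> carrier L \<times> carrier L; b \<in> carrier L \<times> carrier L\<rbrakk>
        \<Longrightarrow> \<nu> a * \<nu> b * \<kappa>_FT a b = \<kappa> a b * \<nu> (a \<otimes>\<^bsub>L \<times>\<times> L\<^esub> b)"
    using C_corr_T_sigma by blast
  have to_from: "to_dual (from_dual \<phi>) = \<phi>" if "\<phi> \<in> carrier (dual L)" for \<phi>
    using that by (simp add: to_dual_def from_dual_def)
  have from_to: "from_dual (to_dual k) = k" if "k \<in> carrier L" for k
    using that by (simp add: to_dual_def from_dual_def)
  have from_closed: "from_dual \<phi> \<in> carrier L" if "\<phi> \<in> carrier (dual L)" for \<phi>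
    using that by (simp add: from_dual_def)
  \<comment> \<open>The inverse in \<open>\<kappa>_FT\<close> cancels the inversion in
    \<open>from_dual\<close>, leaving \<open>\<psi> l1\<close>.\<close>
  have kappa_ev: "kappa_ev (l1, \<phi>) (l2, \<psi>) = \<kappa>_FT (l1, from_dual \<phi>) (l2, from_dual \<psi>)"
    if "l1 \<in> carrier L" "\<psi> \<in> carrier (dual L)" for l1 l2 \<phi> \<psi>
    using that by (simp add: kappa_ev_def \<kappa>_FT_def from_dual_def \<sigma>_inv_apply)
  \<comment> \<open>\<open>\<nu>\<close> rescales from \<open>\<kappa>_FT\<close> to
    \<open>\<kappa>\<close>; the passage here is from \<open>\<kappa>\<close> to the Heisenberg
    cocycle, hence the inverse.\<close>
  interpret fwd: cohomologous L L "dual L" to_dual from_dual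
    "\<lambda>c. inverse (\<nu> (apsnd from_dual c))" \<kappa> kappa_ev
  proof (unfold_locales, goal_cases)
    case 1
    show ?case by (auto simp: hom_def to_dual_def L.inv_mult)
  next
    case 2
    show ?case by (auto simp: hom_def from_dual_def L.inv_mult)
  next
    case (6 c d)
    obtain l1 \<phi> l2 \<psi> where cd: "c = (l1, \<phi>)" "d = (l2, \<psi>)"
      and mem: "l1 \<in> carrier L" "\<phi> \<in> carrier (dual L)" "l2 \<in> carrier L" "\<psi> \<in> carrier (dual L)"
      using 6 by auto
    have k: "from_dual \<phi> \<in> carrier L" "from_dual \<psi> \<in> carrier L"
      "from_dual (\<phi> \<otimes>\<^bsub>dual L\<^esub> \<psi>) = from_dual \<phi> \<otimes>\<^bsub>L\<^esub> from_dual \<psi>"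
      using mem by (simp_all add: from_dual_def L.inv_mult)
    let ?a = "(l1, from_dual \<phi>)" and ?b = "(l2, from_dual \<psi>)"
    have "\<nu> ?a * \<nu> ?b * \<kappa>_FT ?a ?b = \<kappa> ?a ?b * \<nu> (?a \<otimes>\<^bsub>L \<times>\<times> L\<^esub> ?b)"
      by (rule \<nu>(2)) (use mem k in auto)
    moreover have "\<nu> ?a \<noteq> 0" "\<nu> ?b \<noteq> 0" "\<nu> (?a \<otimes>\<^bsub>L \<times>\<times> L\<^esub> ?b) \<noteq> 0"
      using mem k by (auto intro!: \<nu>(1))
    ultimately show ?case
      using mem k(3) by (simp add: cd kappa_ev field_simps)
  qed (auto simp: to_from from_to from_closed intro!: \<nu>(1))
  have S1: "restrict_right (\<lambda>y. y) fwd.S1 = Sum3 L L (C_corr L (T_sigma L \<sigma>))"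
    by (simp add: restrict_right_id C)
  have S2: "restrict_right to_dual fwd.S2 = FT_sigma L \<sigma>"
    by (simp add: FT_sigma_def FT_pt_def to_dual_def[abs_def])
  interpret bwd: cohomologous L "dual L" L from_dual to_dual
    "\<lambda>c. inverse (inverse (\<nu> (apsnd from_dual (apsnd to_dual c))))" kappa_ev \<kappa>
    by (rule fwd.cohomologous_sym)
  interpret F: strict_bimodule_iso "Vect L" "Vect L" "Sum3 L L (C_corr L (T_sigma L \<sigma>))" "FT_sigma L \<sigma>"
    fwd.FO fwd.FA
    unfolding S1[symmetric] S2[symmetric] by (rule fwd.strict_iso_relabel) auto
  \<comment> \<open>Now \<open>t\<close> is \<open>from_dual\<close> and the restricted category is
    the source, so the compatibility of restriction maps reads
    \<open>from_dual (to_dual k) = k\<close>.\<close>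
  interpret B: strict_bimodule_iso "Vect L" "Vect L" "FT_sigma L \<sigma>" "Sum3 L L (C_corr L (T_sigma L \<sigma>))"
    bwd.FO bwd.FA
    unfolding S1[symmetric] S2[symmetric] by (rule bwd.strict_iso_relabel) (auto simp: from_to)
  have Id: "Id V X \<in> Arr V"
    if "V = Vect L" "X \<in> Ob V" for V :: "('l list, 'l list \<times> 'k mat \<times> 'l list, 'k) moncat" and X
    using that Id_Vect_in_Arr[OF L.is_monoid] by simp
  show "bimodule_equivalent (Vect L) (Vect L) N (Sum3 L L (C_corr L (T_sigma L \<sigma>))) \<longleftrightarrow>
      bimodule_equivalent (Vect L) (Vect L) N (FT_sigma L \<sigma>)"
    using F.bimodule_equivalent_compose[OF Id[OF refl] Id[OF refl]] B.bimodule_equivalent_compose[OF Id[OF refl] Id[OF refl]] by blast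
  have "bimodule_equivalent (Vect L) (Vect L) (Sum3 L L (C_corr L (T_sigma L \<sigma>)))
      (Sum3 L L (C_corr L (T_sigma L \<sigma>)))"
    using fwd.S1.equivalent_refl by (simp add: C)
  then show "bimodule_equivalent (Vect L) (Vect L) (Sum3 L L (C_corr L (T_sigma L \<sigma>))) (FT_sigma L \<sigma>)"
    using F.bimodule_equivalent_compose[OF Id[OF refl] Id[OF refl]] by blast
qed

end

theorem mainTheorem3:
  fixes L :: "'l monoid"
    and \<sigma> :: "'l \<Rightarrow> 'l \<Rightarrow> 'k::{alg_closed_field, field_char_0}"
  assumes "comm_group L" and "finite (carrier L)"
    and "\<sigma> \<in> iso L (dual L)"
    and "\<forall>k \<in> carrier L. \<forall>l \<in> carrier L. \<sigma> l k = \<sigma> k l"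
  shows "T_sigma L \<sigma> \<in> carrier (orthogonal_group L)
    \<and> T_sigma L \<sigma> \<otimes>\<^bsub>orthogonal_group L\<^esub> T_sigma L \<sigma> = \<one>\<^bsub>orthogonal_group L\<^esub>
    \<and> (carrier L \<noteq> {\<one>\<^bsub>L\<^esub>} \<longrightarrow> T_sigma L \<sigma> \<noteq> \<one>\<^bsub>orthogonal_group L\<^esub>)
    \<and> f_map L (T_sigma L \<sigma>) = bimodule_class L (FT_sigma L \<sigma>)
    \<and> bimodule_equivalent (Vect L) (Vect L) (Sum3 L L (C_corr L (T_sigma L \<sigma>))) (FT_sigma L \<sigma>)"
proof -
  interpret symmetric_self_duality L \<sigma>
    using assms by (intro symmetric_self_duality.intro symmetric_self_duality_axioms.intro) auto
  show ?thesis
    \<comment> \<open>Both classes impose the same invertibility on \<open>N\<close> and differ only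
      in the target of the equivalence, so the criterion for each \<open>N\<close> makes them equal
      as sets.\<close>
    using T_sigma_in_orthogonal_group T_sigma_square T_sigma_nontrivial
      equivalent_Sum3_C_corr_iff_FT_sigma equivalent_Sum3_C_corr_FT_sigma
    unfolding f_map_def bimodule_class_def by blast
qed

end
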